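(* Let $(\mathbf B_t)_{t\ge0}$ and $(\mathbf B'_t)_{t\ge0}$ be any two co-adapted Heisenberg Brownian motions starting respectively in $a=(x,y,z)$ and $a'=(x',y',z')$ with $(x'-x)^2+(y'-y)^2>0$. Then $$\limsup_{t\to+\infty}\mathbb E\left[d_{\mathbb H}(\mathbf B_t,\mathbf B'_t)^2\right]=+\infty.$$
   Context: Heisenberg group: $\mathbb H=\mathbb R^3$ with the group law $(x,y,z)\cdot(x',y',z')=\left(x+x',y+y',z+z'+\tfrac12(xy'-yx')\right)$. Left-invariant vector fields: $X=\partial_x-\tfrac y2\partial_z$, $Y=\partial_y+\tfrac x2\partial_z$. Distance: $d_{\mathbb H}(a,a')=\inf_\gamma\int_0^1|\dot\gamma(t)|_{\mathrm h}\,dt$, the infimum being over horizontal curves $\gamma:[0,1]\to\mathbb H$ from $a$ to $a'$, i.e. absolutely continuous curves with $\dot\gamma(t)\in\mathrm{Vect}(X(\gamma(t)),Y(\gamma(t)))$ for almost every $t$; $|\cdot|_{\mathrm h}$ is the Euclidean norm on $\mathrm{Vect}(X,Y)$ making $(X,Y)$ orthonormal (Carnot–Carathéodory distance). Heisenberg Brownian motion starting in $a\in\mathbb H$: a process with the law of $\mathbf B^a_t=a\cdot\left(B^1_t,B^2_t,\tfrac12\left(\int_0^tB^1_s\,dB^2_s-\int_0^tB^2_s\,dB^1_s\right)\right)$, where $B^1,B^2$ are independent standard one-dimensional Brownian motions starting at $0$. It is a continuous Markov process with generator $\tfrac12(X^2+Y^2)$ and semigroup denoted $(P_t)_{t\ge0}$.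 Two Heisenberg Brownian motions $(\mathbf B_t)_{t\ge 0}$, $(\mathbf B'_t)_{t\ge 0}$ are co-adapted if they are defined on (and adapted to) one filtered probability space $(\Omega,(\mathcal F_t)_t,\mathbb P)$ and each of them is Markov with respect to the common filtration $(\mathcal F_t)$ with its own semigroup: for all $s,t\ge0$ and all bounded measurable $f$, $\mathbb E[f(\mathbf B_{s+t})\mid\mathcal F_s]=(P_tf)(\mathbf B_s)$ and $\mathbb E[f(\mathbf B'_{s+t})\mid\mathcal F_s]=(P_tf)(\mathbf B'_s)$ almost surely. *)

theory Defs
  imports "HOL-Probability.Probability"
begin

section \<open>The Heisenberg group and its Carnot-Caratheodory distance\<close>

type_synonym heis = "real \<times> real \<times> real"

fun heis_mult :: "heis \<Rightarrow> heis \<Rightarrow> heis" where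
  "heis_mult (x, y, z) (x', y', z') = (x + x', y + y', z + z' + (x * y' - y * x') / 2)"

fun heis_X :: "heis \<Rightarrow> heis" where
  "heis_X (x, y, z) = (1, 0, - y / 2)"

fun heis_Y :: "heis \<Rightarrow> heis" where
  "heis_Y (x, y, z) = (0, 1, x / 2)"

text \<open>
  The norm on the horizontal plane at \<open>p\<close> that makes \<open>(X p, Y p)\<close> orthonormal. It is meaningful
  only for \<open>w \<in> span {X p, Y p}\<close>, where the coordinates \<open>u\<close>, \<open>v\<close> exist and are unique.
\<close>

definition heis_hnorm :: "heis \<Rightarrow> heis \<Rightarrow> real" where
  "heis_hnorm p w =
     (THE r. \<exists>u v. w = u *\<^sub>R heis_X p + v *\<^sub>R heis_Y p \<and> r = sqrt (u\<^sup>2 + v\<^sup>2))"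

definition abs_continuous_on_interval :: "real \<Rightarrow> real \<Rightarrow> (real \<Rightarrow> 'b::metric_space) \<Rightarrow> bool" where
  "abs_continuous_on_interval a b f \<longleftrightarrow>
     (\<forall>\<epsilon>>0. \<exists>\<delta>>0. \<forall>(n::nat) u v.
        (\<forall>i<n. a \<le> u i \<and> u i \<le> v i \<and> v i \<le> b) \<longrightarrow>
        (\<forall>i<n. \<forall>j<n. i \<noteq> j \<longrightarrow> {u i<..<v i} \<inter> {u j<..<v j} = {}) \<longrightarrow>
        (\<Sum>i<n. v i - u i) < \<delta> \<longrightarrow>
        (\<Sum>i<n. dist (f (u i)) (f (v i))) < \<epsilon>)"

definition horizontal_curve :: "(real \<Rightarrow> heis) \<Rightarrow> bool" where
  "horizontal_curve \<gamma> \<longleftrightarrow>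
     abs_continuous_on_interval 0 1 \<gamma> \<and>
     (AE t in lebesgue. t \<in> {0..1} \<longrightarrow>
        (\<exists>w \<in> span {heis_X (\<gamma> t), heis_Y (\<gamma> t)}. (\<gamma> has_vector_derivative w) (at t)))"

definition heis_length :: "(real \<Rightarrow> heis) \<Rightarrow> ennreal" where
  "heis_length \<gamma> =
     (\<integral>\<^sup>+ t\<in>{0..1}. ennreal (heis_hnorm (\<gamma> t) (vector_derivative \<gamma> (at t))) \<partial>lebesgue)"

text \<open>
  The distance is an infimum in \<open>[0, \<infinity>]\<close>. Any two points are joined by a horizontal curve of finite
  length, so its values are in fact finite.
\<close>

definition heis_dist :: "heis \<Rightarrow> heis \<Rightarrow> ennreal" where
  "heis_dist a a' =
     (INF \<gamma> \<in> {\<gamma>. horizontal_curve \<gamma> \<and> \<gamma> 0 = a \<and> \<gamma> 1 = a'}. heis_length \<gamma>)"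


section \<open>Brownian motion and the Ito integral\<close>

text \<open>Processes are indexed by \<open>real\<close>; only their values at times \<open>t \<ge> 0\<close> are ever used.\<close>

definition standard_bm :: "'w measure \<Rightarrow> (real \<Rightarrow> 'w \<Rightarrow> real) \<Rightarrow> bool" where
  "standard_bm N W \<longleftrightarrow>
     prob_space N \<and>
     (\<forall>t\<ge>0. W t \<in> borel_measurable N) \<and>
     (AE \<omega> in N. W 0 \<omega> = 0) \<and>
     (AE \<omega> in N. continuous_on {0..} (\<lambda>t. W t \<omega>)) \<and>
     (\<forall>s t. 0 \<le> s \<and> s < t \<longrightarrow>
        distributed N lborel (\<lambda>\<omega>. W t \<omega> - W s \<omega>) (normal_density 0 (sqrt (t - s)))) \<and>
     (\<forall>(n::nat) \<tau>. 0 \<le> \<tau> 0 \<and> (\<forall>i<n. \<tau> i \<le> \<tau> (Suc i)) \<longrightarrow>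
        prob_space.indep_vars N (\<lambda>_. borel) (\<lambda>i \<omega>. W (\<tau> (Suc i)) \<omega> - W (\<tau> i) \<omega>) {..<n})"

text \<open>The whole process as a random element of the product space.\<close>

definition trajectory :: "(real \<Rightarrow> 'w \<Rightarrow> 'b) \<Rightarrow> 'w \<Rightarrow> real \<Rightarrow> 'b" where
  "trajectory Z \<omega> = (\<lambda>t\<in>{0..}. Z t \<omega>)"

abbreviation path_space :: "(real \<Rightarrow> 'b::topological_space) measure" where
  "path_space \<equiv> (\<Pi>\<^sub>M t\<in>{0..}. borel)"

definition natural_filtration ::
    "'w measure \<Rightarrow> (real \<Rightarrow> 'w \<Rightarrow> 'b::topological_space) \<Rightarrow> real \<Rightarrow> 'w measure" where
  "natural_filtration N Z t =
     vimage_algebra (space N) (\<lambda>\<omega>. \<lambda>s\<in>{0..t}. Z s \<omega>) (\<Pi>\<^sub>M s\<in>{0..t}. borel)"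

text \<open>
  A simple process on \<open>[0, T]\<close> is given by a partition \<open>\<tau> 0 \<le> \<dots> \<le> \<tau> n\<close> and by bounded random
  variables \<open>\<xi> i\<close>, each \<open>\<xi> i\<close> being known at time \<open>\<tau> i\<close>; \<open>\<xi> i\<close> is its value on \<open>(\<tau> i, \<tau> (i + 1)]\<close>.
\<close>

type_synonym 'w simple_process = "nat \<times> (nat \<Rightarrow> real) \<times> (nat \<Rightarrow> 'w \<Rightarrow> real)"

fun simple_adapted ::
    "'w measure \<Rightarrow> (real \<Rightarrow> 'w measure) \<Rightarrow> real \<Rightarrow> 'w simple_process \<Rightarrow> bool" where
  "simple_adapted N G T (n, \<tau>, \<xi>) \<longleftrightarrow>
     0 \<le> \<tau> 0 \<and> \<tau> n \<le> T \<and> (\<forall>i<n. \<tau> i \<le> \<tau> (Suc i)) \<and>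
     (\<forall>i<n. \<xi> i \<in> borel_measurable (G (\<tau> i)) \<and> (\<exists>C. \<forall>\<omega>\<in>space N. \<bar>\<xi> i \<omega>\<bar> \<le> C))"

fun simple_value :: "'w simple_process \<Rightarrow> real \<Rightarrow> 'w \<Rightarrow> real" where
  "simple_value (n, \<tau>, \<xi>) s \<omega> = (\<Sum>i<n. \<xi> i \<omega> * indicator {\<tau> i<..\<tau> (Suc i)} s)"

fun simple_integral_wrt :: "(real \<Rightarrow> 'w \<Rightarrow> real) \<Rightarrow> 'w simple_process \<Rightarrow> 'w \<Rightarrow> real" where
  "simple_integral_wrt W (n, \<tau>, \<xi>) \<omega> = (\<Sum>i<n. \<xi> i \<omega> * (W (\<tau> (Suc i)) \<omega> - W (\<tau> i) \<omega>))"

text \<open>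
  \<open>has_ito_integral N G H W T I\<close>: the random variable \<open>I\<close> is a version of the Ito integral
  \<open>\<integral>\<^sub>0\<^sup>T H dW\<close>, where \<open>W\<close> is a Brownian motion with respect to the filtration \<open>G\<close>. By the Ito
  isometry \<open>I\<close> is determined almost surely and does not depend on the approximating sequence.
\<close>

definition has_ito_integral ::
    "'w measure \<Rightarrow> (real \<Rightarrow> 'w measure) \<Rightarrow> (real \<Rightarrow> 'w \<Rightarrow> real) \<Rightarrow> (real \<Rightarrow> 'w \<Rightarrow> real)
      \<Rightarrow> real \<Rightarrow> ('w \<Rightarrow> real) \<Rightarrow> bool" where
  "has_ito_integral N G H W T I \<longleftrightarrow>
     I \<in> borel_measurable N \<and>
     (\<exists>S :: nat \<Rightarrow> 'w simple_process.
        (\<forall>k. simple_adapted N G T (S k)) \<and>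
        (\<lambda>k. \<integral>\<^sup>+ \<omega>. (\<integral>\<^sup>+ s\<in>{0..T}. ennreal ((H s \<omega> - simple_value (S k) s \<omega>)\<^sup>2) \<partial>lborel) \<partial>N)
          \<longlonglongrightarrow> 0 \<and>
        (\<lambda>k. \<integral>\<^sup>+ \<omega>. ennreal ((I \<omega> - simple_integral_wrt W (S k) \<omega>)\<^sup>2) \<partial>N) \<longlonglongrightarrow> 0)"


section \<open>Heisenberg Brownian motion\<close>

text \<open>
  \<open>heis_bm_model N Z\<close>: on the probability space \<open>N\<close>, the process \<open>Z\<close> is
  \<open>(B\<^sup>1, B\<^sup>2, 1/2 (\<integral> B\<^sup>1 dB\<^sup>2 - \<integral> B\<^sup>2 dB\<^sup>1))\<close> for independent standard Brownian motions \<open>B\<^sup>1\<close>, \<open>B\<^sup>2\<close>.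
  The two Ito integrals \<open>J\<close>, \<open>K\<close> are taken as continuous processes. Such \<open>Z\<close> serve as the
  reference process that defines the law of Heisenberg Brownian motion and its semigroup; neither
  depends on the chosen \<open>N\<close> and \<open>Z\<close>.
\<close>

definition heis_bm_model :: "'w measure \<Rightarrow> (real \<Rightarrow> 'w \<Rightarrow> heis) \<Rightarrow> bool" where
  "heis_bm_model N Z \<longleftrightarrow>
     (\<exists>B1 B2 J K.
        standard_bm N B1 \<and> standard_bm N B2 \<and>
        prob_space.indep_var N path_space (trajectory B1) path_space (trajectory B2) \<and>
        (let G = natural_filtration N (\<lambda>t \<omega>. (B1 t \<omega>, B2 t \<omega>)) in
           \<forall>t\<ge>0. has_ito_integral N G B1 B2 t (J t) \<and> has_ito_integral N G B2 B1 t (K t)) \<and>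
        (AE \<omega> in N. continuous_on {0..} (\<lambda>t. J t \<omega>) \<and> continuous_on {0..} (\<lambda>t. K t \<omega>)) \<and>
        (\<forall>t\<ge>0. \<forall>\<omega>\<in>space N. Z t \<omega> = (B1 t \<omega>, B2 t \<omega>, (J t \<omega> - K t \<omega>) / 2)))"

text \<open>The semigroup \<open>(P\<^sub>t f) a = E[f (a \<cdot> Z\<^sub>t)]\<close>.\<close>

definition heis_semigroup ::
    "'w measure \<Rightarrow> (real \<Rightarrow> 'w \<Rightarrow> heis) \<Rightarrow> real \<Rightarrow> (heis \<Rightarrow> real) \<Rightarrow> heis \<Rightarrow> real" where
  "heis_semigroup N Z t f a = (\<integral>\<omega>. f (heis_mult a (Z t \<omega>)) \<partial>N)"

text \<open>
  \<open>B\<close> is a Heisenberg Brownian motion starting in \<open>a\<close>: a continuous process whose law on path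
  space is that of \<open>a \<cdot> Z\<close>.
\<close>

definition heis_bm ::
    "'w measure \<Rightarrow> (real \<Rightarrow> 'w \<Rightarrow> heis) \<Rightarrow> heis \<Rightarrow> 'a measure \<Rightarrow> (real \<Rightarrow> 'a \<Rightarrow> heis) \<Rightarrow> bool" where
  "heis_bm N Z a M B \<longleftrightarrow>
     prob_space M \<and>
     (\<forall>t\<ge>0. B t \<in> borel_measurable M) \<and>
     (AE \<omega> in M. continuous_on {0..} (\<lambda>t. B t \<omega>)) \<and>
     distr M path_space (trajectory B) = distr N path_space (trajectory (\<lambda>t \<omega>. heis_mult a (Z t \<omega>)))"

definition filtration_of :: "'a measure \<Rightarrow> (real \<Rightarrow> 'a measure) \<Rightarrow> bool" where
  "filtration_of M F \<longleftrightarrow>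
     (\<forall>t\<ge>0. subalgebra M (F t)) \<and> (\<forall>s t. 0 \<le> s \<and> s \<le> t \<longrightarrow> sets (F s) \<subseteq> sets (F t))"

definition markov_wrt ::
    "'w measure \<Rightarrow> (real \<Rightarrow> 'w \<Rightarrow> heis) \<Rightarrow> 'a measure \<Rightarrow> (real \<Rightarrow> 'a measure)
      \<Rightarrow> (real \<Rightarrow> 'a \<Rightarrow> heis) \<Rightarrow> bool" where
  "markov_wrt N Z M F B \<longleftrightarrow>
     (\<forall>s\<ge>0. \<forall>t\<ge>0. \<forall>f \<in> borel_measurable borel. bounded (range f) \<longrightarrow>
        (AE \<omega> in M. real_cond_exp M (F s) (\<lambda>\<omega>. f (B (s + t) \<omega>)) \<omega>
                      = heis_semigroup N Z t f (B s \<omega>)))"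

definition co_adapted ::
    "'w measure \<Rightarrow> (real \<Rightarrow> 'w \<Rightarrow> heis) \<Rightarrow> 'a measure \<Rightarrow> (real \<Rightarrow> 'a measure)
      \<Rightarrow> (real \<Rightarrow> 'a \<Rightarrow> heis) \<Rightarrow> (real \<Rightarrow> 'a \<Rightarrow> heis) \<Rightarrow> bool" where
  "co_adapted N Z M F B B' \<longleftrightarrow>
     filtration_of M F \<and>
     (\<forall>t\<ge>0. B t \<in> borel_measurable (F t) \<and> B' t \<in> borel_measurable (F t)) \<and>
     markov_wrt N Z M F B \<and> markov_wrt N Z M F B'"

end

theory Submission
  imports Defs
begin

text \<open>
  Suppose \<open>E[d\<^sup>2]\<close> stays below \<open>C\<close> for large times. A horizontal curve of length \<open>l\<close> moves the plane
  coordinates by at most \<open>l\<close> and the area coordinate by at most \<open>l\<^sup>2\<close>, so the planar difference \<open>R\<close>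
  of the two processes is bounded in \<open>L\<^sup>2\<close> and the area \<open>A\<close> between them is bounded in \<open>L\<^sup>1\<close>. Since
  \<open>R\<close> is a martingale, its increment \<open>\<rho>\<close> over a window \<open>[s, s + t]\<close> of fixed length tends to \<open>0\<close> in
  \<open>L\<^sup>2\<close> along some sequence \<open>s \<rightarrow> \<infinity>\<close>. Let \<open>(\<beta>, \<zeta>)\<close> and \<open>(\<beta>', \<zeta>')\<close> be the increments of the two processes
  over the window. Both have the law of \<open>Z\<^sub>t\<close> and are independent of \<open>F\<^sub>s\<close>, and
  \<open>A\<^sub>s\<^sub>+\<^sub>t = A\<^sub>s + R\<^sub>s \<and> \<beta> + (\<zeta>' - \<zeta>) + (R\<^sub>s \<and> \<rho> - \<beta> \<and> \<rho>) / 2\<close>, with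
  \<open>u \<and> v = u\<^sub>1 v\<^sub>2 - u\<^sub>2 v\<^sub>1\<close>. Test this identity against \<open>\<phi>(\<beta>)\<close>, where
  \<open>\<phi>\<close> truncates one coordinate to \<open>[-1, 1]\<close>: as \<open>E[\<zeta>' \<phi>(\<beta>')] = E[\<zeta> \<phi>(\<beta>)]\<close>, the term \<open>\<zeta>' - \<zeta>\<close> contributes only
  \<open>E[\<zeta>' (\<phi>(\<beta>) - \<phi>(\<beta>'))]\<close>, which vanishes with \<open>\<rho>\<close>, however \<open>\<zeta>\<close> and \<open>\<zeta>'\<close> are coupled. What remains is
  \<open>E[R] \<and> E[\<beta> \<phi>(\<beta>)]\<close>, where \<open>E[R]\<close> is the initial planar difference; it is bounded by \<open>2C\<close> up to an
  arbitrarily small error, but it grows like \<open>\<surd>t\<close> unless the other coordinate of \<open>E[R]\<close> is zero.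
\<close>

section \<open>Lower bounds for the Carnot-Caratheodory distance\<close>

text \<open>The vertical coordinate of \<open>p\<^sup>-\<^sup>1 q\<close>.\<close>

definition heis_area :: "heis \<Rightarrow> heis \<Rightarrow> real" where
  "heis_area p q = snd (snd q) - snd (snd p) - (fst p * fst (snd q) - fst (snd p) * fst q) / 2"

section \<open>Absolutely continuous functions and integrals of their derivatives\<close>

text \<open>Tagged partial divisions are the families that occur in gauge integrals. Enumerating one
  and reading off endpoints with \<open>Inf\<close> and \<open>Sup\<close> gives a finite family of
  the kind quantified over in the definition of absolute continuity.\<close>

lemma abs_continuous_sum_lt:
  assumes "abs_continuous_on_interval a b f" and "\<epsilon> > 0"
  obtains \<delta> where "\<delta> > 0"
    and "\<And>p. p tagged_partial_division_of {a..b} \<Longrightarrow> (\<Sum>(x, k)\<in>p. measure lborel k) < \<delta>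
           \<Longrightarrow> (\<Sum>(x, k)\<in>p. dist (f (Inf k)) (f (Sup k))) < \<epsilon>"
proof -
  obtain \<delta> where "\<delta> > 0" and \<delta>: "\<forall>(n::nat) u v.
        (\<forall>i<n. a \<le> u i \<and> u i \<le> v i \<and> v i \<le> b) \<longrightarrow>
        (\<forall>i<n. \<forall>j<n. i \<noteq> j \<longrightarrow> {u i<..<v i} \<inter> {u j<..<v j} = {}) \<longrightarrow>
        (\<Sum>i<n. v i - u i) < \<delta> \<longrightarrow> (\<Sum>i<n. dist (f (u i)) (f (v i))) < \<epsilon>"
    using assms(1)[unfolded abs_continuous_on_interval_def, THEN spec, THEN mp, OF assms(2)]
    by (elim exE conjE)
  have "(\<Sum>(x, k)\<in>p. dist (f (Inf k)) (f (Sup k))) < \<epsilon>"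
    if p: "p tagged_partial_division_of {a..b}" and lt: "(\<Sum>(x, k)\<in>p. measure lborel k) < \<delta>" for p
  proof -
    have "finite p" using p by (simp add: tagged_partial_division_of_def)
    then obtain h where h: "bij_betw h {..<card p} p"
      using ex_bij_betw_nat_finite atLeast0LessThan by metis
    have box: "\<exists>u v. k = {u..v} \<and> a \<le> u \<and> u \<le> v \<and> v \<le> b" if "(x, k) \<in> p" for x k
    proof -
      from p that have "x \<in> k" "k \<subseteq> {a..b}" "\<exists>u v. k = cbox u v"
        by (auto simp: tagged_partial_division_of_def)
      then show ?thesis by force
    qed
    let ?u = "\<lambda>i. Inf (snd (h i))" and ?v = "\<lambda>i. Sup (snd (h i))"
    have hi: "h i \<in> p" if "i < card p" for i
      using h that by (auto simp: bij_betw_def)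
    have bd: "a \<le> ?u i \<and> ?u i \<le> ?v i \<and> ?v i \<le> b" if "i < card p" for i
      using box[of "fst (h i)" "snd (h i)"] hi[OF that] by auto
    have int: "interior (snd (h i)) = {?u i<..<?v i}" if "i < card p" for i
      using box[of "fst (h i)" "snd (h i)"] hi[OF that] by (auto simp: interior_atLeastAtMost_real)
    have disj: "{?u i<..<?v i} \<inter> {?u j<..<?v j} = {}" if "i < card p" "j < card p" "i \<noteq> j" for i j
    proof -
      have "h i \<noteq> h j" using h that by (auto simp: bij_betw_def inj_on_def)
      then have "interior (snd (h i)) \<inter> interior (snd (h j)) = {}"
        using p hi[OF that(1)] hi[OF that(2)]
        unfolding tagged_partial_division_of_def by (metis prod.collapse)
      then show ?thesis using int that by simp
    qed
    have "(\<Sum>i<card p. ?v i - ?u i) = (\<Sum>q\<in>p. Sup (snd q) - Inf (snd q))"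
      by (rule sum.reindex_bij_betw[OF h])
    also have "\<dots> = (\<Sum>(x, k)\<in>p. measure lborel k)"
      by (intro sum.cong) (auto dest!: box)
    finally have "(\<Sum>i<card p. dist (f (?u i)) (f (?v i))) < \<epsilon>"
      using \<delta>[THEN spec, THEN spec, THEN spec, of "card p" ?u ?v] bd disj lt by simp
    moreover have "(\<Sum>i<card p. dist (f (?u i)) (f (?v i)))
        = (\<Sum>q\<in>p. dist (f (Inf (snd q))) (f (Sup (snd q))))"
      by (rule sum.reindex_bij_betw[OF h])
    ultimately show ?thesis by (simp add: case_prod_unfold)
  qed
  with that \<open>\<delta> > 0\<close> show thesis by blast
qed

text \<open>
  On the null set where the derivative is unspecified, the gauge is that of
  the integral of an indicator: it makes the tagged intervals so short in total that absolute
  continuity bounds their contribution.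
\<close>

lemma abs_continuous_has_integral:
  fixes f f' :: "real \<Rightarrow> real"
  assumes "a \<le> b" and ac: "abs_continuous_on_interval a b f" and neg: "negligible E"
    and der: "\<And>x. x \<in> {a..b} - E \<Longrightarrow> (f has_real_derivative f' x) (at x)"
  shows "(f' has_integral (f b - f a)) {a..b}"
proof -
  \<comment> \<open>With the value 0 on \<open>E\<close>, an interval tagged in \<open>E\<close>
    contributes only its increment of \<open>f\<close>. Changing the integrand back on a negligible
    set at the end leaves the integral unchanged.\<close>
  let ?g = "\<lambda>x. if x \<in> E then 0 else f' x"
  have "(?g has_integral (f b - f a)) {a..b}"
    unfolding has_integral_real
  proof (intro allI impI)
    fix e :: real assume "e > 0"
    \<comment> \<open>Errors of \<open>e'\<close> per unit length add up to at most
      \<open>e / 2\<close>; the \<open>+ 1\<close> covers the case \<open>a = b\<close>.\<close>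
    define e' where "e' = e / (2 * (b - a + 1))"
    have "e' > 0" using \<open>e > 0\<close> \<open>a \<le> b\<close> by (simp add: e'_def)
    have "\<exists>d>0. \<forall>y. \<bar>y - x\<bar> < d \<longrightarrow> \<bar>f y - f x - (y - x) * f' x\<bar> \<le> e' * \<bar>y - x\<bar>"
      if "x \<in> {a..b} - E" for x
    proof -
      have "(f has_derivative (\<lambda>h. h * f' x)) (at x)"
        using der[OF that] by (simp add: has_field_derivative_def mult_commute_abs)
      then show ?thesis
        using \<open>e' > 0\<close> unfolding has_derivative_at_alt by (metis real_norm_def)
    qed
    then obtain d where d: "\<And>x. x \<in> {a..b} - E \<Longrightarrow> d x > 0"
      "\<And>x y. x \<in> {a..b} - E \<Longrightarrow> \<bar>y - x\<bar> < d x \<Longrightarrow> \<bar>f y - f x - (y - x) * f' x\<bar> \<le> e' * \<bar>y - x\<bar>"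
      by metis
    obtain \<delta> where "\<delta> > 0" and
      \<delta>: "\<And>p. p tagged_partial_division_of {a..b} \<Longrightarrow> (\<Sum>(x, k)\<in>p. measure lborel k) < \<delta>
           \<Longrightarrow> (\<Sum>(x, k)\<in>p. dist (f (Inf k)) (f (Sup k))) < e / 2"
      using abs_continuous_sum_lt[OF ac, of "e / 2"] \<open>e > 0\<close> by auto
    have "((indicator E :: real \<Rightarrow> real) has_integral 0) {a..b}"
      using neg unfolding negligible_def by (metis box_real(2))
    then obtain \<gamma> where "gauge \<gamma>" and \<gamma>: "\<And>p. p tagged_division_of {a..b} \<Longrightarrow> \<gamma> fine p \<Longrightarrow>
        norm ((\<Sum>(x, k)\<in>p. measure lborel k *\<^sub>R (indicator E x :: real)) - 0) < \<delta>"
      unfolding has_integral_real using \<open>\<delta> > 0\<close> by meson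
    define \<gamma>' where "\<gamma>' x = \<gamma> x \<inter> (if x \<in> {a..b} - E then ball x (d x) else UNIV)" for x
    have "gauge \<gamma>'"
      unfolding \<gamma>'_def using \<open>gauge \<gamma>\<close> d(1) by (intro gauge_Int) (auto simp: gauge_def)
    moreover have "norm ((\<Sum>(x, k)\<in>p. measure lborel k *\<^sub>R ?g x) - (f b - f a)) < e"
      if p: "p tagged_division_of {a..b}" and fine: "\<gamma>' fine p" for p
    proof -
      have "finite p" using p by blast
      \<comment> \<open>The part of the division tagged in \<open>E\<close>. Its total length is a
        Riemann sum of the indicator of \<open>E\<close>, hence below \<delta>.\<close>
      define q where "q = {(x, k) \<in> p. x \<in> E}"
      have q: "q \<subseteq> p" by (auto simp: q_def)
      then have qp: "q tagged_partial_division_of {a..b}"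
        using p by (auto simp: tagged_division_of_def intro: tagged_partial_division_subset)
      have "(\<Sum>(x, k)\<in>q. measure lborel k) = (\<Sum>(x, k)\<in>p. measure lborel k *\<^sub>R (indicator E x :: real))"
        using \<open>finite p\<close> by (intro sum.mono_neutral_cong_left) (auto simp: q_def indicator_def)
      also have "\<dots> < \<delta>"
      proof -
        have "\<gamma> fine p" using fine unfolding fine_def \<gamma>'_def by blast
        from \<gamma>[OF p this] show ?thesis by simp
      qed
      finally have Q: "(\<Sum>(x, k)\<in>q. \<bar>f (Sup k) - f (Inf k)\<bar>) < e / 2"
        using \<delta>[OF qp] by (simp add: dist_real_def abs_minus_commute)
      \<comment> \<open>The straddle estimate: off \<open>E\<close> both endpoints are close to the
        tag, and the linear approximations at the tag are subtracted from each other.\<close>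
      have tm: "\<bar>measure lborel k *\<^sub>R ?g x - (f (Sup k) - f (Inf k))\<bar>
          \<le> e' * (Sup k - Inf k) + (if x \<in> E then \<bar>f (Sup k) - f (Inf k)\<bar> else 0)"
        if xk: "(x, k) \<in> p" for x k
      proof -
        from p xk have "x \<in> k" "k \<subseteq> {a..b}" "\<exists>u v. k = cbox u v"
          by (auto simp: tagged_division_of_def tagged_partial_division_of_def)
        then obtain u v where k: "k = {u..v}" "u \<le> x" "x \<le> v" "a \<le> u" "v \<le> b" by force
        then have SI: "Sup k = v" "Inf k = u" "measure lborel k = v - u" by auto
        show ?thesis
        proof (cases "x \<in> E")
          case True
          moreover have "0 \<le> e' * (v - u)" using k \<open>e' > 0\<close> by simp
          ultimately show ?thesis unfolding SI by (simp add: abs_minus_commute)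
        next
          case False
          with k have x: "x \<in> {a..b} - E" by auto
          have "k \<subseteq> ball x (d x)"
            using fineD[OF fine xk] x by (simp add: \<gamma>'_def)
          moreover have "u \<in> k" "v \<in> k" using k by auto
          ultimately have "\<bar>u - x\<bar> < d x" "\<bar>v - x\<bar> < d x"
            by (auto simp: dist_real_def dist_commute)
          then have "\<bar>f u - f x - (u - x) * f' x\<bar> \<le> e' * (x - u)"
            "\<bar>f v - f x - (v - x) * f' x\<bar> \<le> e' * (v - x)"
            using d(2)[OF x, of u] d(2)[OF x, of v] k by auto
          then have "\<bar>(f v - f x - (v - x) * f' x) - (f u - f x - (u - x) * f' x)\<bar> \<le> e' * (x - u) + e' * (v - x)"
            by linarith
          also have "(f v - f x - (v - x) * f' x) - (f u - f x - (u - x) * f' x) = f v - f u - (v - u) * f' x"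
            by (simp add: algebra_simps)
          also have "e' * (x - u) + e' * (v - x) = e' * (v - u)" by (simp add: algebra_simps)
          finally show ?thesis using False SI by (simp add: abs_minus_commute)
        qed
      qed
      have "(\<Sum>(x, k)\<in>p. measure lborel k *\<^sub>R ?g x) - (f b - f a)
          = (\<Sum>(x, k)\<in>p. measure lborel k *\<^sub>R ?g x - (f (Sup k) - f (Inf k)))"
        using additive_tagged_division_1[OF \<open>a \<le> b\<close> p, of f]
        by (simp add: sum_subtractf case_prod_unfold)
      also have "\<bar>\<dots>\<bar> \<le> (\<Sum>(x, k)\<in>p. \<bar>measure lborel k *\<^sub>R ?g x - (f (Sup k) - f (Inf k))\<bar>)"
        by (rule order_trans[OF sum_abs]) (simp add: case_prod_unfold)
      also have "\<dots> \<le> (\<Sum>(x, k)\<in>p. e' * (Sup k - Inf k) + (if x \<in> E then \<bar>f (Sup k) - f (Inf k)\<bar> else 0))"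
      proof (rule sum_mono)
        fix y assume "y \<in> p"
        then show "(case y of (x, k) \<Rightarrow> \<bar>measure lborel k *\<^sub>R ?g x - (f (Sup k) - f (Inf k))\<bar>)
            \<le> (case y of (x, k) \<Rightarrow> e' * (Sup k - Inf k) + (if x \<in> E then \<bar>f (Sup k) - f (Inf k)\<bar> else 0))"
          using tm[of "fst y" "snd y"] unfolding case_prod_unfold prod.collapse by blast
      qed
      also have "\<dots> = e' * (\<Sum>(x, k)\<in>p. Sup k - Inf k) + (\<Sum>(x, k)\<in>p. if x \<in> E then \<bar>f (Sup k) - f (Inf k)\<bar> else 0)"
        by (simp add: case_prod_unfold sum.distrib sum_distrib_left)
      also have "(\<Sum>(x, k)\<in>p. Sup k - Inf k) = b - a"
        using additive_tagged_division_1[OF \<open>a \<le> b\<close> p, of "\<lambda>x. x"] by simp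
      also have "(\<Sum>(x, k)\<in>p. if x \<in> E then \<bar>f (Sup k) - f (Inf k)\<bar> else 0)
          = (\<Sum>(x, k)\<in>q. \<bar>f (Sup k) - f (Inf k)\<bar>)"
        using \<open>finite p\<close> by (intro sum.mono_neutral_cong_right) (auto simp: q_def split: if_splits)
      also have "e' * (b - a) + \<dots> < e"
      proof -
        have "e' * (b - a) \<le> e / 2"
          using \<open>a \<le> b\<close> \<open>e > 0\<close> by (simp add: e'_def field_simps)
        with Q show ?thesis by linarith
      qed
      finally show ?thesis by simp
    qed
    ultimately show "\<exists>\<gamma>. gauge \<gamma> \<and> (\<forall>p. p tagged_division_of {a..b} \<and> \<gamma> fine p \<longrightarrow>
        norm ((\<Sum>(x, k)\<in>p. measure lborel k *\<^sub>R ?g x) - (f b - f a)) < e)"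
      by (intro exI[of _ \<gamma>'] conjI allI impI) auto
  qed
  then show ?thesis
    by (rule has_integral_spike[OF neg, rotated]) auto
qed

text \<open>If the right side is infinite, nothing is to be shown. Otherwise \<open>f'\<close> is
  Lebesgue integrable on the interval and its gauge and Lebesgue integrals agree. Only monotonicity
  of \<open>nn_integral\<close> is applied to \<open>g\<close>, so \<open>g\<close> may be any
  function, such as the speed of a horizontal curve.\<close>

lemma abs_continuous_diff_le_nn_integral:
  fixes f f' :: "real \<Rightarrow> real"
  assumes "a \<le> b" and ac: "abs_continuous_on_interval a b f" and neg: "negligible E"
    and der: "\<And>x. x \<in> {a..b} - E \<Longrightarrow> (f has_real_derivative f' x) (at x)"
    and le: "\<And>x. x \<in> {a..b} - E \<Longrightarrow> \<bar>f' x\<bar> \<le> g x"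
  shows "ennreal \<bar>f b - f a\<bar> \<le> (\<integral>\<^sup>+ x\<in>{a..b}. ennreal (g x) \<partial>lebesgue)"
proof -
  let ?h = "\<lambda>x. indicator {a..b} x *\<^sub>R f' x"
  have I: "(f' has_integral (f b - f a)) {a..b}"
    by (rule abs_continuous_has_integral[OF assms(1-4)])
  then have "f' \<in> borel_measurable (lebesgue_on {a..b})"
    using integrable_imp_measurable has_integral_integrable by blast
  then have meas: "?h \<in> borel_measurable lebesgue"
    by (simp add: borel_measurable_restrict_space_iff)
  have "AE x in lebesgue. x \<notin> E"
    using neg by (simp add: negligible_iff_null_sets AE_not_in)
  then have N: "(\<integral>\<^sup>+ x. ennreal \<bar>?h x\<bar> \<partial>lebesgue) \<le> (\<integral>\<^sup>+ x\<in>{a..b}. ennreal (g x) \<partial>lebesgue)"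
  proof (intro nn_integral_mono_AE, eventually_elim)
    case (elim x)
    then show ?case using le[of x] by (auto simp: indicator_def ennreal_leI)
  qed
  show ?thesis
  proof (cases "(\<integral>\<^sup>+ x\<in>{a..b}. ennreal (g x) \<partial>lebesgue) = \<infinity>")
    case True then show ?thesis by simp
  next
    case False
    with N have "(\<integral>\<^sup>+ x. ennreal \<bar>?h x\<bar> \<partial>lebesgue) < \<infinity>"
      by (simp add: order_le_less_trans less_top)
    then have int: "integrable lebesgue ?h"
      using meas by (simp add: integrable_iff_bounded)
    then have "(f' has_integral (LINT x : {a..b} | lebesgue. f' x)) {a..b}"
      by (intro has_integral_set_lebesgue) (simp add: set_integrable_def)
    with I have "f b - f a = (\<integral>x. ?h x \<partial>lebesgue)"
      unfolding set_lebesgue_integral_def using has_integral_unique by blast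
    then have "\<bar>f b - f a\<bar> \<le> (\<integral>x. \<bar>?h x\<bar> \<partial>lebesgue)"
      using integral_abs_bound by metis
    then have "ennreal \<bar>f b - f a\<bar> \<le> ennreal (\<integral>x. \<bar>?h x\<bar> \<partial>lebesgue)" by (rule ennreal_leI)
    also have "\<dots> = (\<integral>\<^sup>+ x. ennreal \<bar>?h x\<bar> \<partial>lebesgue)"
      using int by (subst nn_integral_eq_integral) auto
    finally show ?thesis using N by order
  qed
qed

lemma abs_continuous_on_subinterval:
  assumes "abs_continuous_on_interval a b f" "a \<le> c" "d \<le> b"
  shows "abs_continuous_on_interval c d f"
  unfolding abs_continuous_on_interval_def
proof (intro allI impI)
  fix \<epsilon> :: real assume "\<epsilon> > 0"
  from assms(1)[unfolded abs_continuous_on_interval_def, THEN spec, THEN mp, OF this]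
  obtain \<delta> where \<delta>: "\<delta> > 0" "\<forall>(n::nat) u v.
        (\<forall>i<n. a \<le> u i \<and> u i \<le> v i \<and> v i \<le> b) \<longrightarrow>
        (\<forall>i<n. \<forall>j<n. i \<noteq> j \<longrightarrow> {u i<..<v i} \<inter> {u j<..<v j} = {}) \<longrightarrow>
        (\<Sum>i<n. v i - u i) < \<delta> \<longrightarrow> (\<Sum>i<n. dist (f (u i)) (f (v i))) < \<epsilon>"
    by (elim exE conjE)
  show "\<exists>\<delta>>0. \<forall>(n::nat) u v.
        (\<forall>i<n. c \<le> u i \<and> u i \<le> v i \<and> v i \<le> d) \<longrightarrow>
        (\<forall>i<n. \<forall>j<n. i \<noteq> j \<longrightarrow> {u i<..<v i} \<inter> {u j<..<v j} = {}) \<longrightarrow>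
        (\<Sum>i<n. v i - u i) < \<delta> \<longrightarrow> (\<Sum>i<n. dist (f (u i)) (f (v i))) < \<epsilon>"
  proof (rule exI, rule conjI[OF \<delta>(1)], intro allI impI)
    fix n :: nat and u v
    assume "\<forall>i<n. c \<le> u i \<and> u i \<le> v i \<and> v i \<le> d"
      and *: "\<forall>i<n. \<forall>j<n. i \<noteq> j \<longrightarrow> {u i<..<v i} \<inter> {u j<..<v j} = {}" "(\<Sum>i<n. v i - u i) < \<delta>"
    then have "\<forall>i<n. a \<le> u i \<and> u i \<le> v i \<and> v i \<le> b"
      using assms(2,3) by force
    then show "(\<Sum>i<n. dist (f (u i)) (f (v i))) < \<epsilon>"
      using \<delta>(2)[THEN spec, THEN spec, THEN spec, of n u v] * by simp
  qed
qed

text \<open>Transfers absolute continuity from a curve to its coordinates and to linear combinations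
  of them.\<close>

lemma abs_continuous_on_interval_lipschitz:
  assumes "abs_continuous_on_interval a b f" "C \<ge> 0"
    and C: "\<And>s t. dist (g s) (g t) \<le> C * dist (f s) (f t)"
  shows "abs_continuous_on_interval a b g"
  unfolding abs_continuous_on_interval_def
proof (intro allI impI)
  fix \<epsilon> :: real assume "\<epsilon> > 0"
  \<comment> \<open>The \<open>+ 1\<close> keeps the denominator positive when
    \<open>C = 0\<close>.\<close>
  then have "\<epsilon> / (C + 1) > 0" using assms(2) by simp
  from assms(1)[unfolded abs_continuous_on_interval_def, THEN spec, THEN mp, OF this]
  obtain \<delta> where \<delta>: "\<delta> > 0" "\<forall>(n::nat) u v.
        (\<forall>i<n. a \<le> u i \<and> u i \<le> v i \<and> v i \<le> b) \<longrightarrow>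
        (\<forall>i<n. \<forall>j<n. i \<noteq> j \<longrightarrow> {u i<..<v i} \<inter> {u j<..<v j} = {}) \<longrightarrow>
        (\<Sum>i<n. v i - u i) < \<delta> \<longrightarrow> (\<Sum>i<n. dist (f (u i)) (f (v i))) < \<epsilon> / (C + 1)"
    by (elim exE conjE)
  show "\<exists>\<delta>>0. \<forall>(n::nat) u v.
        (\<forall>i<n. a \<le> u i \<and> u i \<le> v i \<and> v i \<le> b) \<longrightarrow>
        (\<forall>i<n. \<forall>j<n. i \<noteq> j \<longrightarrow> {u i<..<v i} \<inter> {u j<..<v j} = {}) \<longrightarrow>
        (\<Sum>i<n. v i - u i) < \<delta> \<longrightarrow> (\<Sum>i<n. dist (g (u i)) (g (v i))) < \<epsilon>"
  proof (rule exI, rule conjI[OF \<delta>(1)], intro allI impI)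
    fix n :: nat and u v
    assume *: "\<forall>i<n. a \<le> u i \<and> u i \<le> v i \<and> v i \<le> b"
      "\<forall>i<n. \<forall>j<n. i \<noteq> j \<longrightarrow> {u i<..<v i} \<inter> {u j<..<v j} = {}" "(\<Sum>i<n. v i - u i) < \<delta>"
    let ?S = "\<Sum>i<n. dist (f (u i)) (f (v i))"
    have S: "?S < \<epsilon> / (C + 1)" "0 \<le> ?S"
      using \<delta>(2)[THEN spec, THEN spec, THEN spec, of n u v] * by (simp_all add: sum_nonneg)
    have "(\<Sum>i<n. dist (g (u i)) (g (v i))) \<le> C * ?S"
      unfolding sum_distrib_left by (intro sum_mono C)
    also have "\<dots> \<le> (C + 1) * ?S" using S(2) by (simp add: algebra_simps)
    also have "\<dots> < \<epsilon>" using S(1) assms(2) by (simp add: field_simps)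
    finally show "(\<Sum>i<n. dist (g (u i)) (g (v i))) < \<epsilon>" .
  qed
qed

section \<open>Length of horizontal curves\<close>

text \<open>The first two components of the vector are \<open>u\<close> and \<open>v\<close>, so the
  coordinates, and with them the definite description, are unique.\<close>

lemma heis_hnorm_eq:
  "heis_hnorm p (u *\<^sub>R heis_X p + v *\<^sub>R heis_Y p) = sqrt (u\<^sup>2 + v\<^sup>2)"
  unfolding heis_hnorm_def
proof (rule the_equality)
  fix r assume "\<exists>u' v'. u *\<^sub>R heis_X p + v *\<^sub>R heis_Y p = u' *\<^sub>R heis_X p + v' *\<^sub>R heis_Y p
    \<and> r = sqrt (u'\<^sup>2 + v'\<^sup>2)"
  then show "r = sqrt (u\<^sup>2 + v\<^sup>2)" by (cases p) auto
qed auto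

text \<open>The planar coordinates have derivatives \<open>u\<close>, \<open>v\<close>, bounded by
  the speed \<open>g\<close>. The area swept out from the starting point changes at a rate of at
  most the planar displacement times \<open>g\<close>, and this displacement is at most the length
  \<open>l\<close>; integration gives \<open>l\<close> squared.\<close>

lemma horizontal_curve_length_bounds:
  assumes "horizontal_curve \<gamma>"
  shows "ennreal \<bar>fst (\<gamma> 1) - fst (\<gamma> 0)\<bar> \<le> heis_length \<gamma>"
    and "ennreal \<bar>fst (snd (\<gamma> 1)) - fst (snd (\<gamma> 0))\<bar> \<le> heis_length \<gamma>"
    and "ennreal \<bar>heis_area (\<gamma> 0) (\<gamma> 1)\<bar> \<le> (heis_length \<gamma>)\<^sup>2"
proof -
  define g where "g t = heis_hnorm (\<gamma> t) (vector_derivative \<gamma> (at t))" for t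
  have L: "heis_length \<gamma> = (\<integral>\<^sup>+ t\<in>{0..1}. ennreal (g t) \<partial>lebesgue)"
    by (simp add: heis_length_def g_def)
  have ac: "abs_continuous_on_interval 0 1 \<gamma>"
    using assms by (simp add: horizontal_curve_def)
  have "AE t in lebesgue. t \<in> {0..1} \<longrightarrow>
      (\<exists>w \<in> span {heis_X (\<gamma> t), heis_Y (\<gamma> t)}. (\<gamma> has_vector_derivative w) (at t))"
    using assms by (simp add: horizontal_curve_def)
  then obtain E where E': "\<And>t. t \<in> space lebesgue - E \<Longrightarrow> t \<in> {0..1} \<longrightarrow>
      (\<exists>w \<in> span {heis_X (\<gamma> t), heis_Y (\<gamma> t)}. (\<gamma> has_vector_derivative w) (at t))"
    and E: "E \<in> null_sets lebesgue"
    by (rule AE_E3) (rule that; assumption)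
  have hor: "\<exists>w \<in> span {heis_X (\<gamma> t), heis_Y (\<gamma> t)}. (\<gamma> has_vector_derivative w) (at t)"
    if "t \<in> {0..1} - E" for t using E'[of t] that by simp
  have neg: "negligible E" using E by (simp add: negligible_iff_null_sets)
  have "\<exists>u v. (\<gamma> has_vector_derivative (u *\<^sub>R heis_X (\<gamma> t) + v *\<^sub>R heis_Y (\<gamma> t))) (at t)
      \<and> g t = sqrt (u\<^sup>2 + v\<^sup>2)" if t: "t \<in> {0..1} - E" for t
  proof -
    obtain w where w: "w \<in> span {heis_X (\<gamma> t), heis_Y (\<gamma> t)}" "(\<gamma> has_vector_derivative w) (at t)"
      using hor[OF t] by blast
    then obtain u v where "w - u *\<^sub>R heis_X (\<gamma> t) = v *\<^sub>R heis_Y (\<gamma> t)"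
      by (auto simp: span_insert span_singleton)
    then have "w = u *\<^sub>R heis_X (\<gamma> t) + v *\<^sub>R heis_Y (\<gamma> t)" by (simp add: algebra_simps)
    with w(2) show ?thesis
      by (metis g_def heis_hnorm_eq vector_derivative_at)
  qed
  then obtain u v where uv: "\<And>t. t \<in> {0..1} - E \<Longrightarrow>
        (\<gamma> has_vector_derivative (u t *\<^sub>R heis_X (\<gamma> t) + v t *\<^sub>R heis_Y (\<gamma> t))) (at t)"
      "\<And>t. t \<in> {0..1} - E \<Longrightarrow> g t = sqrt ((u t)\<^sup>2 + (v t)\<^sup>2)"
    by metis
  define \<gamma>1 \<gamma>2 \<gamma>3 where "\<gamma>1 t = fst (\<gamma> t)" and "\<gamma>2 t = fst (snd (\<gamma> t))" and "\<gamma>3 t = snd (snd (\<gamma> t))" for t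
  have XY: "heis_X (\<gamma> t) = (1, 0, - \<gamma>2 t / 2)" "heis_Y (\<gamma> t) = (0, 1, \<gamma>1 t / 2)" for t
    by (cases "\<gamma> t"; simp add: \<gamma>1_def \<gamma>2_def)+
  have d1: "(\<gamma>1 has_real_derivative u t) (at t)"
    and d2: "(\<gamma>2 has_real_derivative v t) (at t)"
    and d3: "(\<gamma>3 has_real_derivative (v t * \<gamma>1 t - u t * \<gamma>2 t) / 2) (at t)"
    if "t \<in> {0..1} - E" for t
  proof -
    note d = uv(1)[OF that, unfolded XY has_vector_derivative_def]
    note f = has_derivative_fst[OF d] has_derivative_fst[OF has_derivative_snd[OF d]]
      has_derivative_snd[OF has_derivative_snd[OF d]]
    show "(\<gamma>1 has_real_derivative u t) (at t)"
      using f(1) by (simp add: \<gamma>1_def[abs_def] has_field_derivative_def mult_commute_abs)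
    show "(\<gamma>2 has_real_derivative v t) (at t)"
      using f(2) by (simp add: \<gamma>2_def[abs_def] has_field_derivative_def mult_commute_abs)
    have "(\<lambda>h. snd (snd (h *\<^sub>R (u t *\<^sub>R (1, 0, - \<gamma>2 t / 2) + v t *\<^sub>R (0, 1, \<gamma>1 t / 2)))))
        = (*) ((v t * \<gamma>1 t - u t * \<gamma>2 t) / 2)"
      by (rule ext) (simp add: field_simps)
    with f(3) show "(\<gamma>3 has_real_derivative (v t * \<gamma>1 t - u t * \<gamma>2 t) / 2) (at t)"
      unfolding \<gamma>3_def has_field_derivative_def by metis
  qed
  have uvg: "\<bar>u t\<bar> \<le> g t" "\<bar>v t\<bar> \<le> g t" if "t \<in> {0..1} - E" for t
    using uv(2)[OF that] by (auto simp: real_le_rsqrt)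
  have g0: "g t \<ge> 0" if "t \<in> {0..1} - E" for t
    using uv(2)[OF that] by simp
  have lip1: "dist (\<gamma>1 s) (\<gamma>1 t) \<le> 1 * dist (\<gamma> s) (\<gamma> t)" for s t
    by (simp add: \<gamma>1_def dist_fst_le)
  have lip2: "dist (\<gamma>2 s) (\<gamma>2 t) \<le> 1 * dist (\<gamma> s) (\<gamma> t)" for s t
    unfolding \<gamma>2_def using order_trans[OF dist_fst_le dist_snd_le] by simp
  have lip3: "dist (\<gamma>3 s) (\<gamma>3 t) \<le> 1 * dist (\<gamma> s) (\<gamma> t)" for s t
    unfolding \<gamma>3_def using order_trans[OF dist_snd_le dist_snd_le] by simp
  have ac1: "abs_continuous_on_interval 0 1 \<gamma>1"
    by (rule abs_continuous_on_interval_lipschitz[OF ac _ lip1]) simp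
  have ac2: "abs_continuous_on_interval 0 1 \<gamma>2"
    by (rule abs_continuous_on_interval_lipschitz[OF ac _ lip2]) simp
  \<comment> \<open>All intermediate times are needed, since the area estimate uses the displacement
    along the whole curve.\<close>
  have bd1: "ennreal \<bar>\<gamma>1 t - \<gamma>1 0\<bar> \<le> heis_length \<gamma>"
    and bd2: "ennreal \<bar>\<gamma>2 t - \<gamma>2 0\<bar> \<le> heis_length \<gamma>" if "t \<in> {0..1}" for t
  proof -
    have sub: "{0..t} - E \<subseteq> {0..1} - E" and "0 \<le> t" "t \<le> 1" using that by auto
    have le: "(\<integral>\<^sup>+ s\<in>{0..t}. ennreal (g s) \<partial>lebesgue) \<le> heis_length \<gamma>"
      unfolding L using that by (intro nn_integral_mono) (auto simp: indicator_def)
    have "ennreal \<bar>\<gamma>1 t - \<gamma>1 0\<bar> \<le> (\<integral>\<^sup>+ s\<in>{0..t}. ennreal (g s) \<partial>lebesgue)"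
      using sub d1 uvg \<open>0 \<le> t\<close> \<open>t \<le> 1\<close>
      by (intro abs_continuous_diff_le_nn_integral[OF _ _ neg]
            abs_continuous_on_subinterval[OF ac1]) blast+
    with le show "ennreal \<bar>\<gamma>1 t - \<gamma>1 0\<bar> \<le> heis_length \<gamma>" by order
    have "ennreal \<bar>\<gamma>2 t - \<gamma>2 0\<bar> \<le> (\<integral>\<^sup>+ s\<in>{0..t}. ennreal (g s) \<partial>lebesgue)"
      using sub d2 uvg \<open>0 \<le> t\<close> \<open>t \<le> 1\<close>
      by (intro abs_continuous_diff_le_nn_integral[OF _ _ neg]
            abs_continuous_on_subinterval[OF ac2]) blast+
    with le show "ennreal \<bar>\<gamma>2 t - \<gamma>2 0\<bar> \<le> heis_length \<gamma>" by order
  qed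
  from bd1[of 1] show "ennreal \<bar>fst (\<gamma> 1) - fst (\<gamma> 0)\<bar> \<le> heis_length \<gamma>" by (simp add: \<gamma>1_def)
  from bd2[of 1] show "ennreal \<bar>fst (snd (\<gamma> 1)) - fst (snd (\<gamma> 0))\<bar> \<le> heis_length \<gamma>" by (simp add: \<gamma>2_def)
  show "ennreal \<bar>heis_area (\<gamma> 0) (\<gamma> 1)\<bar> \<le> (heis_length \<gamma>)\<^sup>2"
  proof (cases "heis_length \<gamma>")
    case top
    then show ?thesis by (simp add: power2_eq_square ennreal_mult_top)
  next
    case (real l)
    \<comment> \<open>\<open>h t - h 0\<close> is
      \<open>heis_area (\<gamma> 0) (\<gamma> t)\<close>. In the derivative of \<open>h\<close> the
      coordinates occur only relative to the starting point.\<close>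
    define h where "h t = \<gamma>3 t - (\<gamma>1 0 * \<gamma>2 t - \<gamma>2 0 * \<gamma>1 t) / 2" for t
    \<comment> \<open>Dividing \<open>h\<close> by \<open>c\<close> brings its derivative below
      \<open>g\<close>, so the integral bound applies with the length itself. For
      \<open>l = 0\<close> the derivative of \<open>h\<close> vanishes off \<open>E\<close> and any
      positive \<open>c\<close> serves.\<close>
    define c where "c = (if l = 0 then 1 else l)"
    have c: "c > 0" "l * g' / c \<le> g'" if "g' \<ge> 0" for g' :: real
      using real that by (auto simp: c_def)
    let ?C = "1 + \<bar>\<gamma>1 0\<bar> + \<bar>\<gamma>2 0\<bar>"
    have "abs_continuous_on_interval 0 1 h"
    proof (rule abs_continuous_on_interval_lipschitz[OF ac, of ?C])
      fix s t
      let ?d = "dist (\<gamma> s) (\<gamma> t)"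
      have "h s - h t = (\<gamma>3 s - \<gamma>3 t) - \<gamma>1 0 / 2 * (\<gamma>2 s - \<gamma>2 t) + \<gamma>2 0 / 2 * (\<gamma>1 s - \<gamma>1 t)"
        by (simp add: h_def field_simps)
      then have "\<bar>h s - h t\<bar> \<le> \<bar>\<gamma>3 s - \<gamma>3 t\<bar> + \<bar>\<gamma>1 0 / 2\<bar> * \<bar>\<gamma>2 s - \<gamma>2 t\<bar> + \<bar>\<gamma>2 0 / 2\<bar> * \<bar>\<gamma>1 s - \<gamma>1 t\<bar>"
        using abs_triangle_ineq4 abs_triangle_ineq unfolding abs_mult[symmetric] by linarith
      also have "\<dots> \<le> ?d + \<bar>\<gamma>1 0\<bar> * ?d + \<bar>\<gamma>2 0\<bar> * ?d"
        using lip1[of s t] lip2[of s t] lip3[of s t]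
        by (intro add_mono mult_mono) (auto simp: dist_real_def)
      finally show "dist (h s) (h t) \<le> ?C * ?d" by (simp add: dist_real_def algebra_simps)
    qed simp
    then have ach: "abs_continuous_on_interval 0 1 (\<lambda>t. h t / c)"
      by (rule abs_continuous_on_interval_lipschitz[of _ _ _ "1 / c"])
        (use c[of 0] in \<open>auto simp: dist_real_def diff_divide_distrib[symmetric]\<close>)
    have "ennreal \<bar>h 1 / c - h 0 / c\<bar> \<le> heis_length \<gamma>"
      unfolding L
    proof (rule abs_continuous_diff_le_nn_integral[OF _ ach neg])
      fix t assume t: "t \<in> {0..1} - E"
      let ?D = "((\<gamma>1 t - \<gamma>1 0) * v t - (\<gamma>2 t - \<gamma>2 0) * u t) / 2"
      have "(h has_real_derivative ?D) (at t)"
        unfolding h_def[abs_def]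
        by (auto intro!: derivative_eq_intros d1[OF t] d2[OF t] d3[OF t] simp: field_simps)
      then show "((\<lambda>t. h t / c) has_real_derivative ?D / c) (at t)"
        by (rule DERIV_cdivide)
      have "\<bar>\<gamma>1 t - \<gamma>1 0\<bar> \<le> l" "\<bar>\<gamma>2 t - \<gamma>2 0\<bar> \<le> l"
        using bd1[of t] bd2[of t] t real by auto
      then have "\<bar>(\<gamma>1 t - \<gamma>1 0) * v t\<bar> \<le> l * g t" "\<bar>(\<gamma>2 t - \<gamma>2 0) * u t\<bar> \<le> l * g t"
        using uvg[OF t] g0[OF t] real unfolding abs_mult by (auto intro!: mult_mono)
      moreover have "\<bar>(p - q) / 2\<bar> \<le> r" if "\<bar>p\<bar> \<le> r" "\<bar>q\<bar> \<le> r" for p q r :: real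
        using that by (auto simp: abs_le_iff)
      ultimately have "\<bar>?D\<bar> \<le> l * g t" by blast
      then have "\<bar>?D\<bar> / c \<le> l * g t / c"
        using c[of 0] by (intro divide_right_mono) auto
      then show "\<bar>?D / c\<bar> \<le> g t" using c[OF g0[OF t]] by simp
    qed simp
    then have "\<bar>h 1 - h 0\<bar> \<le> l * c"
      using real c[of 0] by (simp add: diff_divide_distrib[symmetric] field_simps)
    moreover have "\<bar>h 1 - h 0\<bar> \<le> 0" if "l = 0"
      using calculation that by simp
    ultimately have "\<bar>h 1 - h 0\<bar> \<le> l\<^sup>2"
      by (auto simp: c_def power2_eq_square split: if_splits)
    then have "ennreal \<bar>h 1 - h 0\<bar> \<le> (heis_length \<gamma>)\<^sup>2"
      using real by (simp add: ennreal_power)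
    moreover have "h 1 - h 0 = heis_area (\<gamma> 0) (\<gamma> 1)"
      by (simp add: h_def heis_area_def \<gamma>1_def \<gamma>2_def \<gamma>3_def field_simps)
    ultimately show ?thesis by simp
  qed
qed

text \<open>A lower bound for all lengths passes to the infimum. The infimum is over lengths, not
  their squares, so the area bound goes through its square root.\<close>

lemma heis_dist_bounds:
  shows "ennreal \<bar>fst q - fst p\<bar> \<le> heis_dist p q"
    and "ennreal \<bar>fst (snd q) - fst (snd p)\<bar> \<le> heis_dist p q"
    and "ennreal \<bar>heis_area p q\<bar> \<le> (heis_dist p q)\<^sup>2"
proof -
  show "ennreal \<bar>fst q - fst p\<bar> \<le> heis_dist p q"
    "ennreal \<bar>fst (snd q) - fst (snd p)\<bar> \<le> heis_dist p q"
    unfolding heis_dist_def by (intro INF_greatest; use horizontal_curve_length_bounds in force)+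
  let ?s = "sqrt \<bar>heis_area p q\<bar>"
  have "ennreal ?s \<le> heis_dist p q"
    unfolding heis_dist_def
  proof (rule INF_greatest)
    fix \<gamma> assume "\<gamma> \<in> {\<gamma>. horizontal_curve \<gamma> \<and> \<gamma> 0 = p \<and> \<gamma> 1 = q}"
    then have *: "ennreal \<bar>heis_area p q\<bar> \<le> (heis_length \<gamma>)\<^sup>2"
      using horizontal_curve_length_bounds(3) by auto
    show "ennreal ?s \<le> heis_length \<gamma>"
    proof (cases "heis_length \<gamma>")
      case (real l)
      with * show ?thesis by (simp add: ennreal_power real_sqrt_le_iff real_le_lsqrt)
    qed simp
  qed
  then have "(ennreal ?s)\<^sup>2 \<le> (heis_dist p q)\<^sup>2" by (rule power_mono) simp
  then show "ennreal \<bar>heis_area p q\<bar> \<le> (heis_dist p q)\<^sup>2"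
    by (simp add: ennreal_power)
qed

section \<open>Increments of a Heisenberg Brownian motion\<close>

lemma heis_mult_eq:
  "heis_mult p q = (fst p + fst q, fst (snd p) + fst (snd q),
     snd (snd p) + snd (snd q) + (fst p * fst (snd q) - fst (snd p) * fst q) / 2)"
  by (cases p; cases q) simp

text \<open>The group element obtained by multiplying \<open>q\<close> from the left by the inverse
  of \<open>p\<close>.\<close>

definition heis_ldiff :: "heis \<Rightarrow> heis \<Rightarrow> heis" where
  "heis_ldiff p q = (fst q - fst p, fst (snd q) - fst (snd p), heis_area p q)"

lemma heis_ldiff_mult [simp]: "heis_ldiff p (heis_mult p q) = q"
  by (simp add: heis_ldiff_def heis_area_def heis_mult_eq prod_eq_iff field_simps)

lemma heis_ldiff_sel:
  "fst (heis_ldiff p q) = fst q - fst p"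
  "fst (snd (heis_ldiff p q)) = fst (snd q) - fst (snd p)"
  "snd (snd (heis_ldiff p q)) = heis_area p q"
  by (simp_all add: heis_ldiff_def)

lemma borel_measurable_fst_snd [measurable (raw)]:
  fixes f :: "'a \<Rightarrow> 'b::second_countable_topology \<times> 'c::second_countable_topology"
  assumes "f \<in> borel_measurable M"
  shows "(\<lambda>x. fst (f x)) \<in> borel_measurable M" "(\<lambda>x. snd (f x)) \<in> borel_measurable M"
  using assms by (auto intro!: measurable_compose[OF assms] borel_measurable_continuous_onI continuous_intros)

lemma measurable_heis_area [measurable (raw)]:
  assumes [measurable]: "f \<in> borel_measurable M" "g \<in> borel_measurable M"
  shows "(\<lambda>x. heis_area (f x) (g x)) \<in> borel_measurable M"
  unfolding heis_area_def by measurable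

lemma measurable_heis_mult [measurable (raw)]:
  assumes [measurable]: "f \<in> borel_measurable M" "g \<in> borel_measurable M"
  shows "(\<lambda>x. heis_mult (f x) (g x)) \<in> borel_measurable M"
  unfolding heis_mult_eq by (intro borel_measurable_Pair) measurable

lemma measurable_heis_ldiff [measurable (raw)]:
  assumes [measurable]: "f \<in> borel_measurable M" "g \<in> borel_measurable M"
  shows "(\<lambda>x. heis_ldiff (f x) (g x)) \<in> borel_measurable M"
  unfolding heis_ldiff_def by (intro borel_measurable_Pair) measurable

text \<open>The measurable rectangles are stable under intersection, generate the product and
  include the whole space.\<close>

lemma measure_eqI_rectangles:
  assumes "finite_measure P" and P: "sets P = sets (S \<Otimes>\<^sub>M T)" and Q: "sets Q = sets (S \<Otimes>\<^sub>M T)"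
    and eq: "\<And>C D. C \<in> sets S \<Longrightarrow> D \<in> sets T \<Longrightarrow> emeasure P (C \<times> D) = emeasure Q (C \<times> D)"
  shows "P = Q"
proof (rule measure_eqI_generator_eq)
  let ?E = "{a \<times> b |a b. a \<in> sets S \<and> b \<in> sets T}"
  show "Int_stable ?E" by (rule Int_stable_pair_measure_generator)
  show "?E \<subseteq> Pow (space S \<times> space T)" by (rule pair_measure_closed)
  show "sets P = sigma_sets (space S \<times> space T) ?E" "sets Q = sigma_sets (space S \<times> space T) ?E"
    by (simp_all add: P Q sets_pair_measure)
  show "range (\<lambda>_::nat. space S \<times> space T) \<subseteq> ?E" by auto
  show "emeasure P (space S \<times> space T) \<noteq> \<infinity>"
    using assms(1) by (simp add: finite_measure.emeasure_finite)
qed (use eq in auto)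

text \<open>Integrating the Markov property over events of \<open>F s\<close> shows that
  \<open>(X, B s, B (s + t))\<close> has the law of \<open>(X, B s, heis_mult (B s) (Z t))\<close>,
  where \<open>Z t\<close> lives on a second factor of the probability space. Taking left
  differences then removes \<open>B s\<close>.\<close>

lemma markov_increment_distr:
  assumes "prob_space M" "prob_space N" and [measurable]: "Z t \<in> borel_measurable N"
    and sub: "subalgebra M (F s)"
    and BsF: "B s \<in> borel_measurable (F s)" and [measurable]: "B (s + t) \<in> borel_measurable M"
    and markov: "markov_wrt N Z M F B" and "s \<ge> 0" "t \<ge> 0"
    and XF: "X \<in> measurable (F s) S"
  shows "distr M (S \<Otimes>\<^sub>M borel) (\<lambda>\<omega>. (X \<omega>, heis_ldiff (B s \<omega>) (B (s + t) \<omega>)))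
    = distr M S X \<Otimes>\<^sub>M distr N borel (Z t)"
proof -
  interpret M: prob_space M by fact
  interpret N: prob_space N by fact
  interpret MN: pair_prob_space M N ..
  interpret F: finite_measure_subalgebra M "F s" by unfold_locales (rule sub)
  note [measurable] = measurable_from_subalg[OF sub BsF] measurable_from_subalg[OF sub XF]
  let ?T = "borel :: heis measure"
  have "distr M ((S \<Otimes>\<^sub>M ?T) \<Otimes>\<^sub>M ?T) (\<lambda>\<omega>. ((X \<omega>, B s \<omega>), B (s + t) \<omega>))
    = distr (M \<Otimes>\<^sub>M N) ((S \<Otimes>\<^sub>M ?T) \<Otimes>\<^sub>M ?T) (\<lambda>(\<omega>, w). ((X \<omega>, B s \<omega>), heis_mult (B s \<omega>) (Z t w)))"
    (is "?P = ?Q")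
  proof (rule measure_eqI_rectangles)
    show "finite_measure ?P" by (rule M.finite_measure_distr) measurable
    fix C :: "(_ \<times> heis) set" and D :: "heis set"
    assume [measurable]: "C \<in> sets (S \<Otimes>\<^sub>M ?T)" "D \<in> sets ?T"
    \<comment> \<open>As an event of \<open>F s\<close>, \<open>A\<close> may be integrated over
      with the conditional expectation in place of the indicator of \<open>D\<close> at
      \<open>B (s + t)\<close>.\<close>
    define A where "A = (\<lambda>\<omega>. (X \<omega>, B s \<omega>)) -` C \<inter> space M"
    have "space (F s) = space M" using sub by (simp add: subalgebra_def)
    moreover have "(\<lambda>\<omega>. (X \<omega>, B s \<omega>)) \<in> measurable (F s) (S \<Otimes>\<^sub>M ?T)"
      using XF BsF by measurable
    ultimately have AF: "A \<in> sets (F s)"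
      unfolding A_def by (metis \<open>C \<in> sets _\<close> measurable_sets)
    then have [measurable]: "A \<in> sets M" using sub by (auto simp: subalgebra_def)
    let ?f = "indicator D :: heis \<Rightarrow> real"
    \<comment> \<open>The semigroup applied to the indicator of \<open>D\<close>, evaluated at
      \<open>B s\<close>.\<close>
    define h where "h \<omega> = (\<integral>w. ?f (heis_mult (B s \<omega>) (Z t w)) \<partial>N)" for \<omega>
    have [measurable]: "h \<in> borel_measurable M" unfolding h_def by measurable
    have h: "0 \<le> h \<omega>" "ennreal (h \<omega>) = (\<integral>\<^sup>+ w. ennreal (?f (heis_mult (B s \<omega>) (Z t w))) \<partial>N)"
      if "\<omega> \<in> space M" for \<omega>
    proof -
      have [measurable]: "(\<lambda>w. heis_mult (B s \<omega>) (Z t w)) \<in> borel_measurable N"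
        by measurable
      show "0 \<le> h \<omega>" by (simp add: h_def)
      show "ennreal (h \<omega>) = (\<integral>\<^sup>+ w. ennreal (?f (heis_mult (B s \<omega>) (Z t w))) \<partial>N)"
        unfolding h_def
        by (subst nn_integral_eq_integral) (auto intro!: N.integrable_const_bound[where B=1])
    qed
    have int: "integrable M (\<lambda>\<omega>. ?f (B (s + t) \<omega>))"
      by (auto intro!: M.integrable_const_bound[where B=1])
    have "bounded (range ?f)" by (auto simp: bounded_iff intro!: exI[of _ 1] split: split_indicator)
    then have "AE \<omega> in M. real_cond_exp M (F s) (\<lambda>\<omega>. ?f (B (s + t) \<omega>)) \<omega> = h \<omega>"
      using markov \<open>s \<ge> 0\<close> \<open>t \<ge> 0\<close> unfolding markov_wrt_def heis_semigroup_def h_def by simp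
    then have "(\<integral>\<omega>\<in>A. real_cond_exp M (F s) (\<lambda>\<omega>. ?f (B (s + t) \<omega>)) \<omega> \<partial>M) = (\<integral>\<omega>\<in>A. h \<omega> \<partial>M)"
      unfolding set_lebesgue_integral_def by (intro integral_cong_AE) auto
    then have "(\<integral>\<omega>\<in>A. ?f (B (s + t) \<omega>) \<partial>M) = (\<integral>\<omega>\<in>A. h \<omega> \<partial>M)"
      using F.real_cond_exp_intA[OF int AF] by simp
    then have key: "(\<integral>\<omega>. indicator A \<omega> * ?f (B (s + t) \<omega>) \<partial>M) = (\<integral>\<omega>. indicator A \<omega> * h \<omega> \<partial>M)"
      by (simp add: set_lebesgue_integral_def)
    have "emeasure ?P (C \<times> D) = (\<integral>\<^sup>+ \<omega>. ennreal (indicator A \<omega> * ?f (B (s + t) \<omega>)) \<partial>M)"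
      by (subst nn_integral_indicator[symmetric], simp, subst nn_integral_distr)
        (auto intro!: nn_integral_cong simp: A_def split: split_indicator)
    also have "\<dots> = ennreal (\<integral>\<omega>. indicator A \<omega> * ?f (B (s + t) \<omega>) \<partial>M)"
      by (intro nn_integral_eq_integral M.integrable_const_bound[where B=1])
        (auto split: split_indicator)
    also have "\<dots> = ennreal (\<integral>\<omega>. indicator A \<omega> * h \<omega> \<partial>M)" by (simp only: key)
    also have "\<dots> = (\<integral>\<^sup>+ \<omega>. ennreal (indicator A \<omega> * h \<omega>) \<partial>M)"
    proof (intro nn_integral_eq_integral[symmetric] M.integrable_const_bound[where B=1] AE_I2)
      fix \<omega> assume "\<omega> \<in> space M"
      have "h \<omega> \<le> (\<integral>w. 1 \<partial>N)" unfolding h_def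
        by (intro integral_mono_AE') (auto split: split_indicator)
      then show "norm (indicator A \<omega> * h \<omega>) \<le> 1"
        using h(1)[OF \<open>\<omega> \<in> space M\<close>] by (auto simp: N.prob_space split: split_indicator)
    qed (use h(1) in auto)
    also have "\<dots> = (\<integral>\<^sup>+ \<omega>. (\<integral>\<^sup>+ w. ennreal (indicator A \<omega> * ?f (heis_mult (B s \<omega>) (Z t w))) \<partial>N) \<partial>M)"
      by (intro nn_integral_cong) (auto simp: h(2) split: split_indicator)
    also have "\<dots> = (\<integral>\<^sup>+ p. ennreal (indicator A (fst p) * ?f (heis_mult (B s (fst p)) (Z t (snd p)))) \<partial>(M \<Otimes>\<^sub>M N))"
      by (subst N.nn_integral_fst[symmetric]) auto
    also have "\<dots> = emeasure ?Q (C \<times> D)"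
      by (subst nn_integral_indicator[symmetric], simp, subst nn_integral_distr)
        (auto intro!: nn_integral_cong simp: A_def space_pair_measure split: split_indicator)
    finally show "emeasure ?P (C \<times> D) = emeasure ?Q (C \<times> D)" .
  qed simp_all
  \<comment> \<open>Under \<open>?Q\<close> this map returns \<open>(X, Z t)\<close>, whose
    components are functions of different factors.\<close>
  then have "distr ?P (S \<Otimes>\<^sub>M ?T) (\<lambda>p. (fst (fst p), heis_ldiff (snd (fst p)) (snd p)))
    = distr ?Q (S \<Otimes>\<^sub>M ?T) (\<lambda>p. (fst (fst p), heis_ldiff (snd (fst p)) (snd p)))" by simp
  then have "distr M (S \<Otimes>\<^sub>M ?T) (\<lambda>\<omega>. (X \<omega>, heis_ldiff (B s \<omega>) (B (s + t) \<omega>)))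
    = distr (M \<Otimes>\<^sub>M N) (S \<Otimes>\<^sub>M ?T) (\<lambda>(\<omega>, w). (X \<omega>, Z t w))"
    by (simp add: distr_distr comp_def case_prod_unfold)
  also have "\<dots> = distr M S X \<Otimes>\<^sub>M distr N borel (Z t)"
    by (subst pair_measure_distr) (auto intro!: prob_space_imp_sigma_finite N.prob_space_distr)
  finally show ?thesis .
qed

text \<open>Splits the product law into its second marginal and a statement of independence. The map
  \<psi> puts the latter in the form used for expectations of products.\<close>

lemma markov_increment:
  assumes "prob_space M" "prob_space N" and Z: "Z t \<in> borel_measurable N"
    and sub: "subalgebra M (F s)"
    and BsF: "B s \<in> borel_measurable (F s)" and Bst: "B (s + t) \<in> borel_measurable M"
    and "markov_wrt N Z M F B" and "s \<ge> 0" "t \<ge> 0"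
    and XF: "X \<in> measurable (F s) S" and \<psi>: "\<psi> \<in> measurable borel T"
  shows "distr M borel (\<lambda>\<omega>. heis_ldiff (B s \<omega>) (B (s + t) \<omega>)) = distr N borel (Z t)"
    and "prob_space.indep_var M S X T (\<lambda>\<omega>. \<psi> (heis_ldiff (B s \<omega>) (B (s + t) \<omega>)))"
proof -
  interpret M: prob_space M by fact
  interpret N: prob_space N by fact
  let ?b = "\<lambda>\<omega>. heis_ldiff (B s \<omega>) (B (s + t) \<omega>)"
  have X: "X \<in> measurable M S" by (rule measurable_from_subalg[OF sub XF])
  have b: "?b \<in> borel_measurable M"
    by (rule measurable_heis_ldiff[OF measurable_from_subalg[OF sub BsF] Bst])
  interpret X: prob_space "distr M S X" by (rule M.prob_space_distr[OF X])
  interpret Z: prob_space "distr N borel (Z t)" by (rule N.prob_space_distr[OF Z])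
  note joint = markov_increment_distr[OF assms(1-10)]
  show eq: "distr M borel ?b = distr N borel (Z t)"
  proof (rule measure_eqI)
    fix A assume "A \<in> sets (distr M borel ?b)"
    then have A: "A \<in> sets borel" by simp
    have "emeasure (distr M borel ?b) A
        = emeasure (distr M (S \<Otimes>\<^sub>M borel) (\<lambda>\<omega>. (X \<omega>, ?b \<omega>))) (space S \<times> A)"
      using A X b measurable_space[OF X]
      by (auto simp: emeasure_distr intro!: arg_cong[where f="emeasure M"])
    also have "\<dots> = emeasure (distr M S X) (space S) * emeasure (distr N borel (Z t)) A"
      unfolding joint using A by (intro Z.emeasure_pair_measure_Times) auto
    also have "\<dots> = emeasure (distr N borel (Z t)) A"
      using X.emeasure_space_1 by simp
    finally show "emeasure (distr M borel ?b) A = emeasure (distr N borel (Z t)) A" .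
  qed simp
  have \<psi>b: "(\<lambda>\<omega>. \<psi> (?b \<omega>)) \<in> measurable M T" by (rule measurable_compose[OF b \<psi>])
  interpret \<psi>Z: prob_space "distr (distr N borel (Z t)) T \<psi>"
    by (rule Z.prob_space_distr) (simp add: \<psi>)
  have "distr M (S \<Otimes>\<^sub>M T) (\<lambda>\<omega>. (X \<omega>, \<psi> (?b \<omega>)))
      = distr (distr M (S \<Otimes>\<^sub>M borel) (\<lambda>\<omega>. (X \<omega>, ?b \<omega>))) (S \<Otimes>\<^sub>M T) (\<lambda>(u, p). (u, \<psi> p))"
    using X b \<psi> by (subst distr_distr) (auto simp: comp_def)
  also have "\<dots> = distr (distr M S X) S (\<lambda>u. u) \<Otimes>\<^sub>M distr (distr N borel (Z t)) T \<psi>"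
    unfolding joint using \<psi>
    by (intro pair_measure_distr[symmetric]) (auto intro: \<psi>Z.sigma_finite_measure_axioms)
  also have "distr (distr M S X) S (\<lambda>u. u) = distr M S X"
    using X by (simp add: distr_distr comp_def)
  also have "distr (distr N borel (Z t)) T \<psi> = distr M T (\<lambda>\<omega>. \<psi> (?b \<omega>))"
    unfolding eq[symmetric] using b \<psi> by (simp add: distr_distr comp_def)
  finally show "M.indep_var S X T (\<lambda>\<omega>. \<psi> (?b \<omega>))"
    unfolding M.indep_var_distribution_eq using X \<psi>b by simp
qed

section \<open>Moments of the reference process\<close>

text \<open>Measurability is a separate conjunct because that of the square does not imply that of
  \<open>f\<close>.\<close>

definition square_integrable :: "'a measure \<Rightarrow> ('a \<Rightarrow> real) \<Rightarrow> bool" where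
  "square_integrable M f \<longleftrightarrow> f \<in> borel_measurable M \<and> integrable M (\<lambda>x. (f x)\<^sup>2)"

lemma square_integrable_measurable: "square_integrable M f \<Longrightarrow> f \<in> borel_measurable M"
  by (simp add: square_integrable_def)

lemma square_integrable_cong:
  assumes "\<And>x. x \<in> space M \<Longrightarrow> f x = g x"
  shows "square_integrable M f \<longleftrightarrow> square_integrable M g"
proof -
  have "f \<in> borel_measurable M \<longleftrightarrow> g \<in> borel_measurable M"
    using assms by (rule measurable_cong)
  moreover have "integrable M (\<lambda>x. (f x)\<^sup>2) \<longleftrightarrow> integrable M (\<lambda>x. (g x)\<^sup>2)"
    by (intro Bochner_Integration.integrable_cong refl) (simp add: assms)
  ultimately show ?thesis by (simp add: square_integrable_def)
qed

lemma square_integrable_mult: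
  assumes "square_integrable M f" "square_integrable M g"
  shows "integrable M (\<lambda>x. f x * g x)"
proof (rule Bochner_Integration.integrable_bound)
  show "integrable M (\<lambda>x. (f x)\<^sup>2 + (g x)\<^sup>2)"
    using assms by (simp add: square_integrable_def)
  show "(\<lambda>x. f x * g x) \<in> borel_measurable M"
    using assms by (auto simp: square_integrable_def intro!: borel_measurable_times)
  have "\<bar>f x * g x\<bar> \<le> (f x)\<^sup>2 + (g x)\<^sup>2" for x
    using sum_squares_bound[of "\<bar>f x\<bar>" "\<bar>g x\<bar>"] abs_ge_zero[of "f x * g x"]
    unfolding abs_mult power2_abs by linarith
  then show "AE x in M. norm (f x * g x) \<le> norm ((f x)\<^sup>2 + (g x)\<^sup>2)" by simp
qed

lemma square_integrable_add:
  assumes "square_integrable M f" "square_integrable M g"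
  shows "square_integrable M (\<lambda>x. f x + g x)"
  using assms square_integrable_mult[OF assms]
  by (auto simp: square_integrable_def power2_sum mult.assoc intro!: borel_measurable_add)

lemma square_integrable_cmult:
  assumes "square_integrable M f"
  shows "square_integrable M (\<lambda>x. c * f x)"
  using assms by (auto simp: square_integrable_def power_mult_distrib intro!: borel_measurable_times)

lemma square_integrable_diff:
  assumes "square_integrable M f" "square_integrable M g"
  shows "square_integrable M (\<lambda>x. f x - g x)"
  using square_integrable_add[OF assms(1) square_integrable_cmult[OF assms(2), of "-1"]] by simp

lemma square_integrable_sum:
  assumes "\<And>i. i \<in> I \<Longrightarrow> square_integrable M (f i)"
  shows "square_integrable M (\<lambda>x. \<Sum>i\<in>I. f i x)"
  using assms
  by (induction I rule: infinite_finite_induct)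
    (auto intro: square_integrable_add simp: square_integrable_def[of M "\<lambda>x. 0"])

lemma square_integrable_bounded_mult:
  assumes "f \<in> borel_measurable M" "\<And>x. x \<in> space M \<Longrightarrow> \<bar>f x\<bar> \<le> C" "square_integrable M g"
  shows "square_integrable M (\<lambda>x. f x * g x)"
  unfolding square_integrable_def
proof
  show *: "(\<lambda>x. f x * g x) \<in> borel_measurable M"
    using assms by (auto simp: square_integrable_def intro!: borel_measurable_times)
  show "integrable M (\<lambda>x. (f x * g x)\<^sup>2)"
  proof (rule Bochner_Integration.integrable_bound)
    show "integrable M (\<lambda>x. C\<^sup>2 * (g x)\<^sup>2)" using assms by (simp add: square_integrable_def)
    have "(f x * g x)\<^sup>2 \<le> C\<^sup>2 * (g x)\<^sup>2" if "x \<in> space M" for x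
      unfolding power_mult_distrib using assms(2)[OF that]
      by (intro mult_right_mono) (auto intro: abs_le_square_iff[THEN iffD1])
    then show "AE x in M. norm ((f x * g x)\<^sup>2) \<le> norm (C\<^sup>2 * (g x)\<^sup>2)" by simp
  qed (use * in \<open>auto intro: borel_measurable_power\<close>)
qed

lemma (in finite_measure) square_integrable_const: "square_integrable M (\<lambda>x. c)"
  by (simp add: square_integrable_def)

lemma (in finite_measure) square_integrable_imp_integrable:
  "square_integrable M f \<Longrightarrow> integrable M f"
  using square_integrable_mult[OF _ square_integrable_const[of 1]] by simp

lemma square_integrable_distr:
  assumes "g \<in> measurable M S"
  shows "f \<in> borel_measurable S \<Longrightarrow> square_integrable (distr M S g) f \<longleftrightarrow> square_integrable M (\<lambda>x. f (g x))"
  using assms by (simp add: square_integrable_def integrable_distr_eq)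

section \<open>Gaussian moments and the Ito integrals\<close>

text \<open>The first absolute moment is the later source of growth like the square root of
  \<open>t\<close>.\<close>

lemma normal_moments:
  assumes "distributed N lborel X (normal_density 0 \<sigma>)" "\<sigma> > 0"
  shows "square_integrable N X" "(\<integral>w. X w \<partial>N) = 0" "(\<integral>w. \<bar>X w\<bar> \<partial>N) = \<sigma> * sqrt (2 / pi)"
proof -
  have X: "X \<in> borel_measurable N" using distributed_measurable[OF assms(1)] by simp
  note I = distributed_integrable[OF assms(1)] distributed_integral[OF assms(1)]
  show "square_integrable N X"
    using I(1)[of "\<lambda>x. x\<^sup>2"] integrable_normal_moment[OF assms(2), of 0 2] X
    by (simp add: square_integrable_def)
  show "(\<integral>w. X w \<partial>N) = 0"
    using I(2)[of "\<lambda>x. x"] integral_normal_moment_nz_1[OF assms(2), of 0] by simp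
  show "(\<integral>w. \<bar>X w\<bar> \<partial>N) = \<sigma> * sqrt (2 / pi)"
    using I(2)[of "\<lambda>x. \<bar>x\<bar>"] integral_normal_moment_abs_odd[OF assms(2), of 0 0] by simp
qed

lemma standard_bm_increment:
  assumes "standard_bm N W" "0 \<le> s" "s \<le> t"
  shows "square_integrable N (\<lambda>w. W t w - W s w)"
\<comment> \<open>Partitions of simple processes may repeat a point, while the Gaussian law of
  increments is given for \<open>s < t\<close> only.\<close>
proof (cases "s = t")
  case True
  then show ?thesis by (simp add: square_integrable_def)
next
  case False
  then have "distributed N lborel (\<lambda>w. W t w - W s w) (normal_density 0 (sqrt (t - s)))"
    using assms unfolding standard_bm_def by auto
  from normal_moments(1)[OF this] False assms(3) show ?thesis by simp
qed

text \<open>One approximating simple integral at finite mean square distance suffices: it is itself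
  square integrable, being a finite sum of bounded variables times Brownian increments, and so is
  its difference from \<open>I\<close>.\<close>

lemma has_ito_integral_square_integrable:
  assumes W: "standard_bm N W" and I: "has_ito_integral N G H W t I"
    and G: "\<And>s. s \<ge> 0 \<Longrightarrow> subalgebra N (G s)"
  shows "square_integrable N I"
proof -
  have Im: "I \<in> borel_measurable N" using I by (simp add: has_ito_integral_def)
  obtain S where S: "\<And>k::nat. simple_adapted N G t (S k)"
    and lim: "(\<lambda>k. \<integral>\<^sup>+ \<omega>. ennreal ((I \<omega> - simple_integral_wrt W (S k) \<omega>)\<^sup>2) \<partial>N) \<longlonglongrightarrow> 0"
    using I unfolding has_ito_integral_def by blast
  have "\<forall>\<^sub>F k in sequentially. (\<integral>\<^sup>+ \<omega>. ennreal ((I \<omega> - simple_integral_wrt W (S k) \<omega>)\<^sup>2) \<partial>N) < 1"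
    using order_tendstoD(2)[OF lim, of 1] by simp
  then obtain k where k: "(\<integral>\<^sup>+ \<omega>. ennreal ((I \<omega> - simple_integral_wrt W (S k) \<omega>)\<^sup>2) \<partial>N) < 1"
    using eventually_happens'[OF sequentially_bot] by blast
  obtain n \<tau> \<xi> where Sk: "S k = (n, \<tau>, \<xi>)" by (metis prod.exhaust)
  from S[of k] have *: "0 \<le> \<tau> 0" "\<And>i. i < n \<Longrightarrow> \<tau> i \<le> \<tau> (Suc i)"
    "\<And>i. i < n \<Longrightarrow> \<xi> i \<in> borel_measurable (G (\<tau> i))"
    "\<And>i. i < n \<Longrightarrow> \<exists>C. \<forall>\<omega>\<in>space N. \<bar>\<xi> i \<omega>\<bar> \<le> C"
    by (auto simp: Sk)
  have "square_integrable N (\<lambda>\<omega>. \<xi> i \<omega> * (W (\<tau> (Suc i)) \<omega> - W (\<tau> i) \<omega>))" if i: "i < n" for i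
  proof -
    have "0 \<le> \<tau> i" using i
    proof (induction i)
      case (Suc i) then show ?case using *(2)[of i] by force
    qed (use *(1) in simp)
    moreover obtain C where "\<And>\<omega>. \<omega> \<in> space N \<Longrightarrow> \<bar>\<xi> i \<omega>\<bar> \<le> C" using *(4)[OF i] by blast
    ultimately show ?thesis
      using *(2,3)[OF i] G by (intro square_integrable_bounded_mult standard_bm_increment[OF W])
        (auto intro: measurable_from_subalg)
  qed
  then have U: "square_integrable N (simple_integral_wrt W (S k))"
    unfolding Sk simple_integral_wrt.simps[abs_def] by (intro square_integrable_sum) simp
  then have "(\<lambda>\<omega>. I \<omega> - simple_integral_wrt W (S k) \<omega>) \<in> borel_measurable N"
    using Im by (auto simp: square_integrable_def intro: borel_measurable_diff)
  then have "square_integrable N (\<lambda>\<omega>. I \<omega> - simple_integral_wrt W (S k) \<omega>)"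
    using k by (auto simp: square_integrable_def integrable_iff_bounded intro: less_trans)
  from square_integrable_add[OF this U] show ?thesis by simp
qed

lemma subalgebra_natural_filtration:
  assumes "\<And>s. s \<ge> 0 \<Longrightarrow> Y s \<in> borel_measurable N"
  shows "subalgebra N (natural_filtration N Y t)"
proof -
  have "(\<lambda>\<omega>. \<lambda>s\<in>{0..t}. Y s \<omega>) \<in> measurable N (\<Pi>\<^sub>M s\<in>{0..t}. borel)"
    using assms by (intro measurable_restrict) auto
  then have "sets (natural_filtration N Y t) \<subseteq> sets N"
    unfolding natural_filtration_def by (rule sets_image_in_sets[OF refl])
  then show ?thesis by (simp add: subalgebra_def natural_filtration_def)
qed

text \<open>Collects what the argument uses of the reference process. Of the stochastic area it is
  only a finite second moment.\<close>

lemma heis_bm_model_facts: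
  assumes "heis_bm_model N Z"
  shows "prob_space N"
    and "t \<ge> 0 \<Longrightarrow> Z t \<in> borel_measurable N"
    and "t > 0 \<Longrightarrow> distributed N lborel (\<lambda>w. fst (Z t w)) (normal_density 0 (sqrt t))"
    and "t > 0 \<Longrightarrow> distributed N lborel (\<lambda>w. fst (snd (Z t w))) (normal_density 0 (sqrt t))"
    and "t \<ge> 0 \<Longrightarrow> prob_space.indep_var N borel (\<lambda>w. fst (Z t w)) borel (\<lambda>w. fst (snd (Z t w)))"
    and "t \<ge> 0 \<Longrightarrow> square_integrable N (\<lambda>w. snd (snd (Z t w)))"
proof -
  obtain B1 B2 J K where W: "standard_bm N B1" "standard_bm N B2"
    and ind: "prob_space.indep_var N path_space (trajectory B1) path_space (trajectory B2)"
    and ito: "let G = natural_filtration N (\<lambda>t \<omega>. (B1 t \<omega>, B2 t \<omega>)) in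
           \<forall>t\<ge>0. has_ito_integral N G B1 B2 t (J t) \<and> has_ito_integral N G B2 B1 t (K t)"
    and Z: "\<forall>t\<ge>0. \<forall>\<omega>\<in>space N. Z t \<omega> = (B1 t \<omega>, B2 t \<omega>, (J t \<omega> - K t \<omega>) / 2)"
    using assms unfolding heis_bm_model_def by blast
  show "prob_space N" using W by (simp add: standard_bm_def)
  then interpret N: prob_space N .
  have [measurable]: "B1 t \<in> borel_measurable N" "B2 t \<in> borel_measurable N" if "t \<ge> 0" for t
    using W that by (auto simp: standard_bm_def)
  let ?G = "natural_filtration N (\<lambda>t \<omega>. (B1 t \<omega>, B2 t \<omega>))"
  have G: "subalgebra N (?G s)" for s
    by (rule subalgebra_natural_filtration) (simp add: borel_measurable_Pair)
  have JK: "square_integrable N (J t)" "square_integrable N (K t)" if "t \<ge> 0" for t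
  proof -
    have "has_ito_integral N ?G B1 B2 t (J t)" "has_ito_integral N ?G B2 B1 t (K t)"
      using ito that by (simp_all add: Let_def)
    then show "square_integrable N (J t)" "square_integrable N (K t)"
      using has_ito_integral_square_integrable[where G="?G", OF W(2) _ G]
        has_ito_integral_square_integrable[where G="?G", OF W(1) _ G] by simp_all
  qed
  show "square_integrable N (\<lambda>w. snd (snd (Z t w)))" if "t \<ge> 0"
  proof -
    have "square_integrable N (\<lambda>\<omega>. 1 / 2 * (J t \<omega> - K t \<omega>))"
      by (intro square_integrable_cmult square_integrable_diff JK that)
    then show ?thesis
      using Z that by (subst square_integrable_cong[where g="\<lambda>\<omega>. 1 / 2 * (J t \<omega> - K t \<omega>)"]) auto
  qed
  show "Z t \<in> borel_measurable N" if "t \<ge> 0"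
  proof -
    have [measurable]: "J t \<in> borel_measurable N" "K t \<in> borel_measurable N"
      using JK[OF that] by (auto simp: square_integrable_def)
    have "(\<lambda>\<omega>. (B1 t \<omega>, B2 t \<omega>, (J t \<omega> - K t \<omega>) / 2)) \<in> borel_measurable N"
      using that by (intro borel_measurable_Pair) measurable
    then show ?thesis
      using Z that by (subst measurable_cong[where g="\<lambda>\<omega>. (B1 t \<omega>, B2 t \<omega>, (J t \<omega> - K t \<omega>) / 2)"]) auto
  qed
  have normal: "distributed N lborel (W t) (normal_density 0 (sqrt t))"
    if W: "standard_bm N W" and "t > 0" for W t
  proof -
    have d: "distributed N lborel (\<lambda>\<omega>. W t \<omega> - W 0 \<omega>) (normal_density 0 (sqrt (t - 0)))"
      using W \<open>t > 0\<close> unfolding standard_bm_def by blast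
    have m: "W t \<in> borel_measurable N" "W 0 \<in> borel_measurable N" "AE \<omega> in N. W 0 \<omega> = 0"
      using W \<open>t > 0\<close> unfolding standard_bm_def by auto
    \<comment> \<open>A standard Brownian motion starts at 0 only almost surely, so the two
      variables agree in law rather than pointwise.\<close>
    have "distr N lborel (W t) = distr N lborel (\<lambda>\<omega>. W t \<omega> - W 0 \<omega>)"
      using m by (intro distr_cong_AE) auto
    then show ?thesis using d m(1) by (simp add: distributed_def)
  qed
  show "distributed N lborel (\<lambda>w. fst (Z t w)) (normal_density 0 (sqrt t))"
    "distributed N lborel (\<lambda>w. fst (snd (Z t w))) (normal_density 0 (sqrt t))" if "t > 0"
    using normal[OF W(1) that] normal[OF W(2) that] Z that
    by (auto simp: distributed_def cong: distr_cong measurable_cong)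
  show "N.indep_var borel (\<lambda>w. fst (Z t w)) borel (\<lambda>w. fst (snd (Z t w)))" if "t \<ge> 0"
  proof -
    have c: "(\<lambda>f. f t) \<in> measurable path_space (borel :: real measure)"
      using that by (intro measurable_component_singleton) simp
    have "N.indep_var borel ((\<lambda>f. f t) \<circ> trajectory B1) borel ((\<lambda>f. f t) \<circ> trajectory B2)"
      by (rule N.indep_var_compose[OF ind c c])
    then have "N.indep_var borel (B1 t) borel (B2 t)"
      using that by (simp add: comp_def trajectory_def)
    then show ?thesis
      using Z that by (auto simp: N.indep_var_distribution_eq cong: distr_cong measurable_cong)
  qed
qed

lemma heis_bm_distr:
  assumes "heis_bm N Z a M B" and "t \<ge> 0"
    and Z: "\<And>t. t \<ge> 0 \<Longrightarrow> Z t \<in> borel_measurable N"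
  shows "distr M borel (B t) = distr N borel (\<lambda>w. heis_mult a (Z t w))"
proof -
  let ?Z = "\<lambda>t \<omega>. heis_mult a (Z t \<omega>)"
  have c: "(\<lambda>f. f t) \<in> measurable path_space (borel :: heis measure)"
    using assms(2) by (intro measurable_component_singleton) simp
  have BM: "trajectory B \<in> measurable M path_space"
    unfolding trajectory_def[abs_def] using assms(1)
    by (intro measurable_restrict) (auto simp: heis_bm_def)
  have ZM: "trajectory ?Z \<in> measurable N path_space"
    unfolding trajectory_def[abs_def] using Z
    by (intro measurable_restrict measurable_heis_mult) auto
  have "distr (distr M path_space (trajectory B)) borel (\<lambda>f. f t)
      = distr (distr N path_space (trajectory ?Z)) borel (\<lambda>f. f t)"
    using assms(1) by (simp add: heis_bm_def)
  then show ?thesis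
    using assms(2) by (simp add: distr_distr[OF c BM] distr_distr[OF c ZM] comp_def trajectory_def)
qed

section \<open>The coupled pair\<close>

text \<open>With \<open>q = p b\<close> and \<open>q' = p' b'\<close> in the group, the inverse of
  \<open>q\<close> times \<open>q'\<close> is the inverse of \<open>b\<close>, times the left
  difference of \<open>p\<close> and \<open>p'\<close>, times \<open>b'\<close>. Hence the positions
  enter only through that difference.\<close>

lemma heis_area_increment:
  fixes p p' q q' :: heis
  defines "b \<equiv> heis_ldiff p q" and "b' \<equiv> heis_ldiff p' q'"
    and "R1 \<equiv> fst p' - fst p" and "R2 \<equiv> fst (snd p') - fst (snd p)"
  defines "\<rho>1 \<equiv> fst b' - fst b" and "\<rho>2 \<equiv> fst (snd b') - fst (snd b)"
  shows "heis_area q q' = heis_area p p' + R1 * fst (snd b) - R2 * fst b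
    + (snd (snd b') - snd (snd b)) + (R1 * \<rho>2 - R2 * \<rho>1) / 2 - (fst b * \<rho>2 - fst (snd b) * \<rho>1) / 2"
  unfolding assms heis_ldiff_sel heis_area_def by (simp add: field_simps)

text \<open>Here \<open>f\<close> and \<open>f'\<close> stand for the test function at
  \<open>b\<close> and \<open>b'\<close>. Multiplying the increment identity by \<open>f\<close> and
  exchanging \<open>f\<close> for \<open>f'\<close> beside the area part of \<open>b'\<close> leaves
  errors that all carry a factor \<open>\<rho>1\<close> or \<open>\<rho>2\<close>. Each of the two
  occurs in three products, whence the constant 3.\<close>

lemma heis_area_increment_bound:
  fixes p p' q q' :: heis and \<epsilon> f f' :: real
  defines "b \<equiv> heis_ldiff p q" and "b' \<equiv> heis_ldiff p' q'"
    and "R1 \<equiv> fst p' - fst p" and "R2 \<equiv> fst (snd p') - fst (snd p)"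
  defines "\<rho>1 \<equiv> fst b' - fst b" and "\<rho>2 \<equiv> fst (snd b') - fst (snd b)"
  assumes "\<epsilon> > 0" "\<bar>f\<bar> \<le> 1" "\<bar>f - f'\<bar> \<le> \<bar>\<rho>1\<bar> + \<bar>\<rho>2\<bar>"
  shows "\<bar>heis_area p p' * f + R1 * (fst (snd b) * f) - R2 * (fst b * f)
      + (snd (snd b') * f' - snd (snd b) * f)\<bar>
    \<le> \<bar>heis_area q q'\<bar> + \<epsilon> * (2 * (snd (snd b'))\<^sup>2 + R1\<^sup>2 + R2\<^sup>2 + (fst b)\<^sup>2 + (fst (snd b))\<^sup>2)
      + 3 / \<epsilon> * (\<rho>1\<^sup>2 + \<rho>2\<^sup>2)"
proof -
  \<comment> \<open>A weighted Young inequality: the small weight goes to the factor that is merely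
    bounded in mean square, the large one to the small increment.\<close>
  have am: "\<bar>u\<bar> * \<bar>r\<bar> \<le> \<epsilon> * u\<^sup>2 + r\<^sup>2 / \<epsilon>" for u r :: real
  proof -
    have "0 \<le> (\<epsilon> * \<bar>u\<bar> - \<bar>r\<bar>)\<^sup>2 + \<epsilon> * (\<bar>u\<bar> * \<bar>r\<bar>)" using \<open>\<epsilon> > 0\<close> by simp
    also have "\<dots> = \<epsilon> * (\<epsilon> * u\<^sup>2 + r\<^sup>2 / \<epsilon> - \<bar>u\<bar> * \<bar>r\<bar>)"
      using \<open>\<epsilon> > 0\<close> by (simp add: power2_eq_square algebra_simps)
    finally show ?thesis using \<open>\<epsilon> > 0\<close> by (simp add: zero_le_mult_iff)
  qed
  let ?\<zeta>' = "snd (snd b')"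
  \<comment> \<open>\<open>e1\<close> is the price of the exchange of \<open>f\<close> for
    \<open>f'\<close>; \<open>e2\<close> and \<open>e3\<close> come from the two wedge products with
    \<rho> in the identity.\<close>
  define e1 e2 e3 where "e1 = ?\<zeta>' * (f' - f)" and "e2 = (R1 * \<rho>2 - R2 * \<rho>1) / 2 * f"
    and "e3 = (fst b * \<rho>2 - fst (snd b) * \<rho>1) / 2 * f"
  have "heis_area p p' * f + R1 * (fst (snd b) * f) - R2 * (fst b * f) + (?\<zeta>' * f' - snd (snd b) * f)
      = heis_area q q' * f + e1 - e2 + e3"
    unfolding e1_def e2_def e3_def
    by (subst heis_area_increment[of q q' p p']) (simp add: b_def b'_def R1_def R2_def \<rho>1_def \<rho>2_def field_simps)
  moreover have "\<bar>heis_area q q' * f\<bar> \<le> \<bar>heis_area q q'\<bar>"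
    using assms(8) by (simp add: abs_mult mult_left_le)
  moreover have "\<bar>e1\<bar> \<le> \<bar>?\<zeta>'\<bar> * \<bar>\<rho>1\<bar> + \<bar>?\<zeta>'\<bar> * \<bar>\<rho>2\<bar>"
    using mult_left_mono[OF assms(9), of "\<bar>?\<zeta>'\<bar>"]
    by (simp add: e1_def abs_mult abs_minus_commute distrib_left)
  moreover have half: "\<bar>(u * v - u' * v') / 2 * f\<bar> \<le> \<bar>u\<bar> * \<bar>v\<bar> + \<bar>u'\<bar> * \<bar>v'\<bar>" for u v u' v' :: real
  proof -
    have "\<bar>(u * v - u' * v') / 2 * f\<bar> \<le> \<bar>u * v - u' * v'\<bar> * 1"
      unfolding abs_mult using assms(8) by (intro mult_mono) auto
    also have "\<dots> \<le> \<bar>u\<bar> * \<bar>v\<bar> + \<bar>u'\<bar> * \<bar>v'\<bar>"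
      using abs_triangle_ineq4[of "u * v" "u' * v'"] by (simp add: abs_mult)
    finally show ?thesis .
  qed
  moreover have "\<bar>e2\<bar> \<le> \<bar>R1\<bar> * \<bar>\<rho>2\<bar> + \<bar>R2\<bar> * \<bar>\<rho>1\<bar>" "\<bar>e3\<bar> \<le> \<bar>fst b\<bar> * \<bar>\<rho>2\<bar> + \<bar>fst (snd b)\<bar> * \<bar>\<rho>1\<bar>"
    unfolding e2_def e3_def by (rule half)+
  moreover note am[of ?\<zeta>' \<rho>1] am[of ?\<zeta>' \<rho>2] am[of R1 \<rho>2] am[of R2 \<rho>1] am[of "fst b" \<rho>2] am[of "fst (snd b)" \<rho>1]
  moreover have "\<epsilon> * (2 * ?\<zeta>'\<^sup>2 + R1\<^sup>2 + R2\<^sup>2 + (fst b)\<^sup>2 + (fst (snd b))\<^sup>2) + 3 / \<epsilon> * (\<rho>1\<^sup>2 + \<rho>2\<^sup>2)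
     = (\<epsilon> * ?\<zeta>'\<^sup>2 + \<rho>1\<^sup>2 / \<epsilon>) + (\<epsilon> * ?\<zeta>'\<^sup>2 + \<rho>2\<^sup>2 / \<epsilon>) + (\<epsilon> * R1\<^sup>2 + \<rho>2\<^sup>2 / \<epsilon>) + (\<epsilon> * R2\<^sup>2 + \<rho>1\<^sup>2 / \<epsilon>)
      + (\<epsilon> * (fst b)\<^sup>2 + \<rho>2\<^sup>2 / \<epsilon>) + (\<epsilon> * (fst (snd b))\<^sup>2 + \<rho>1\<^sup>2 / \<epsilon>)"
    by (simp add: algebra_simps)
  ultimately show ?thesis by (smt (verit))
qed

section \<open>Two co-adapted processes and the laws of their increments\<close>

locale heis_coupling = M: prob_space M + N: prob_space N
  for M :: "'a measure" and N :: "'w measure" +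
  fixes Z :: "real \<Rightarrow> 'w \<Rightarrow> heis" and F :: "real \<Rightarrow> 'a measure"
    and B B' :: "real \<Rightarrow> 'a \<Rightarrow> heis" and a a' :: heis
  assumes model: "heis_bm_model N Z"
    and bm: "heis_bm N Z a M B" and bm': "heis_bm N Z a' M B'"
    and co: "co_adapted N Z M F B B'"
begin

lemma Z_measurable [measurable]: "t \<ge> 0 \<Longrightarrow> Z t \<in> borel_measurable N"
  using heis_bm_model_facts(2)[OF model] .

lemma Z_moments:
  assumes "t > 0"
  shows "square_integrable N (\<lambda>w. fst (Z t w))" "square_integrable N (\<lambda>w. fst (snd (Z t w)))"
    "square_integrable N (\<lambda>w. snd (snd (Z t w)))"
    "(\<integral>w. fst (Z t w) \<partial>N) = 0" "(\<integral>w. fst (snd (Z t w)) \<partial>N) = 0"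
    "(\<integral>w. \<bar>fst (Z t w)\<bar> \<partial>N) = sqrt t * sqrt (2 / pi)"
    "(\<integral>w. \<bar>fst (snd (Z t w))\<bar> \<partial>N) = sqrt t * sqrt (2 / pi)"
  using normal_moments[OF heis_bm_model_facts(3)[OF model assms]]
    normal_moments[OF heis_bm_model_facts(4)[OF model assms]]
    heis_bm_model_facts(6)[OF model] assms by auto

lemma subalgebra_F: "s \<ge> 0 \<Longrightarrow> subalgebra M (F s)"
  using co by (simp add: co_adapted_def filtration_of_def)

lemma adapted: "s \<ge> 0 \<Longrightarrow> B s \<in> borel_measurable (F s)" "s \<ge> 0 \<Longrightarrow> B' s \<in> borel_measurable (F s)"
  using co by (simp_all add: co_adapted_def)

lemma B_measurable [measurable]:
  "s \<ge> 0 \<Longrightarrow> B s \<in> borel_measurable M" "s \<ge> 0 \<Longrightarrow> B' s \<in> borel_measurable M"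
  using adapted subalgebra_F measurable_from_subalg by blast+

definition "b s t \<omega> = heis_ldiff (B s \<omega>) (B (s + t) \<omega>)"
definition "b' s t \<omega> = heis_ldiff (B' s \<omega>) (B' (s + t) \<omega>)"
definition "R1 s \<omega> = fst (B' s \<omega>) - fst (B s \<omega>)"
definition "R2 s \<omega> = fst (snd (B' s \<omega>)) - fst (snd (B s \<omega>))"
definition "A s \<omega> = heis_area (B s \<omega>) (B' s \<omega>)"

lemma b_measurable [measurable]:
  "s \<ge> 0 \<Longrightarrow> t \<ge> 0 \<Longrightarrow> b s t \<in> borel_measurable M" "s \<ge> 0 \<Longrightarrow> t \<ge> 0 \<Longrightarrow> b' s t \<in> borel_measurable M"
  unfolding b_def b'_def by measurable

text \<open>Here the common filtration enters: a quantity formed from both processes at time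
  \<open>s\<close> belongs to \<open>F s\<close> and is therefore independent of the later increment
  of either process.\<close>

lemma R_measurable:
  assumes "s \<ge> 0"
  shows "R1 s \<in> borel_measurable (F s)" "R2 s \<in> borel_measurable (F s)" "A s \<in> borel_measurable (F s)"
proof -
  note [measurable] = adapted[OF assms]
  show "R1 s \<in> borel_measurable (F s)" "R2 s \<in> borel_measurable (F s)" "A s \<in> borel_measurable (F s)"
    unfolding R1_def R2_def A_def by measurable
qed

lemma R_measurable_M [measurable]:
  assumes "s \<ge> 0"
  shows "R1 s \<in> borel_measurable M" "R2 s \<in> borel_measurable M" "A s \<in> borel_measurable M"
  using R_measurable[OF assms] subalgebra_F[OF assms] measurable_from_subalg by blast+

lemma increment:
  assumes "s \<ge> 0" "t \<ge> 0"
  shows "distr M borel (b s t) = distr N borel (Z t)" "distr M borel (b' s t) = distr N borel (Z t)"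
    and "X \<in> measurable (F s) S \<Longrightarrow> \<psi> \<in> measurable borel T \<Longrightarrow> M.indep_var S X T (\<lambda>\<omega>. \<psi> (b s t \<omega>))"
    and "X \<in> measurable (F s) S \<Longrightarrow> \<psi> \<in> measurable borel T \<Longrightarrow> M.indep_var S X T (\<lambda>\<omega>. \<psi> (b' s t \<omega>))"
proof -
  have "s + t \<ge> 0" using assms by simp
  have "markov_wrt N Z M F B" "markov_wrt N Z M F B'" using co by (simp_all add: co_adapted_def)
  note * = markov_increment[where Z=Z and F=F, OF M.prob_space_axioms N.prob_space_axioms Z_measurable[OF assms(2)]
      subalgebra_F[OF assms(1)] adapted(1)[OF assms(1)] B_measurable(1)[OF \<open>s + t \<ge> 0\<close>] this(1) assms]
    markov_increment[where Z=Z and F=F, OF M.prob_space_axioms N.prob_space_axioms Z_measurable[OF assms(2)]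
      subalgebra_F[OF assms(1)] adapted(2)[OF assms(1)] B_measurable(2)[OF \<open>s + t \<ge> 0\<close>] this(2) assms]
  show "distr M borel (b s t) = distr N borel (Z t)" "distr M borel (b' s t) = distr N borel (Z t)"
    unfolding b_def[abs_def] b'_def[abs_def]
    \<comment> \<open>The laws do not mention \<open>X\<close> and \<psi>, so constants are supplied
      for them.\<close>
    by (rule *(1)[of "\<lambda>_. 0::real" borel "\<lambda>_. 0::real" borel] *(3)[of "\<lambda>_. 0::real" borel "\<lambda>_. 0::real" borel]; simp)+
  show "M.indep_var S X T (\<lambda>\<omega>. \<psi> (b s t \<omega>))" "M.indep_var S X T (\<lambda>\<omega>. \<psi> (b' s t \<omega>))"
    if "X \<in> measurable (F s) S" "\<psi> \<in> measurable borel T"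
    unfolding b_def b'_def using *(2,4)[OF that] .
qed

text \<open>Expectations of functions of a single increment depend neither on \<open>s\<close> nor
  on the coupling.\<close>

lemma increment_integral:
  fixes \<psi> :: "heis \<Rightarrow> real"
  assumes "s \<ge> 0" "t \<ge> 0" and [measurable]: "\<psi> \<in> borel_measurable borel"
  shows "(\<integral>\<omega>. \<psi> (b s t \<omega>) \<partial>M) = (\<integral>w. \<psi> (Z t w) \<partial>N)"
    and "(\<integral>\<omega>. \<psi> (b' s t \<omega>) \<partial>M) = (\<integral>w. \<psi> (Z t w) \<partial>N)"
    and "integrable M (\<lambda>\<omega>. \<psi> (b s t \<omega>)) \<longleftrightarrow> integrable N (\<lambda>w. \<psi> (Z t w))"
    and "integrable M (\<lambda>\<omega>. \<psi> (b' s t \<omega>)) \<longleftrightarrow> integrable N (\<lambda>w. \<psi> (Z t w))"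
proof -
  note d = increment(1,2)[OF assms(1,2)]
  note [measurable] = b_measurable[OF assms(1,2)] Z_measurable[OF assms(2)]
  show "(\<integral>\<omega>. \<psi> (b s t \<omega>) \<partial>M) = (\<integral>w. \<psi> (Z t w) \<partial>N)"
    "(\<integral>\<omega>. \<psi> (b' s t \<omega>) \<partial>M) = (\<integral>w. \<psi> (Z t w) \<partial>N)"
    using arg_cong[OF d(1), of "\<lambda>m. integral\<^sup>L m \<psi>"] arg_cong[OF d(2), of "\<lambda>m. integral\<^sup>L m \<psi>"]
    by (simp_all add: integral_distr)
  show "integrable M (\<lambda>\<omega>. \<psi> (b s t \<omega>)) \<longleftrightarrow> integrable N (\<lambda>w. \<psi> (Z t w))"
    "integrable M (\<lambda>\<omega>. \<psi> (b' s t \<omega>)) \<longleftrightarrow> integrable N (\<lambda>w. \<psi> (Z t w))"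
    using arg_cong[OF d(1), of "\<lambda>m. integrable m \<psi>"] arg_cong[OF d(2), of "\<lambda>m. integrable m \<psi>"]
    by (simp_all add: integrable_distr_eq)
qed

lemma increment_indep_integral:
  fixes \<psi> :: "heis \<Rightarrow> real"
  assumes "s \<ge> 0" "t \<ge> 0" and \<psi>: "\<psi> \<in> borel_measurable borel" "integrable N (\<lambda>w. \<psi> (Z t w))"
    and X: "X \<in> borel_measurable (F s)" "integrable M X"
  shows "integrable M (\<lambda>\<omega>. X \<omega> * \<psi> (b s t \<omega>))" "integrable M (\<lambda>\<omega>. X \<omega> * \<psi> (b' s t \<omega>))"
    and "(\<integral>\<omega>. X \<omega> * \<psi> (b s t \<omega>) \<partial>M) = (\<integral>\<omega>. X \<omega> \<partial>M) * (\<integral>w. \<psi> (Z t w) \<partial>N)"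
    and "(\<integral>\<omega>. X \<omega> * \<psi> (b' s t \<omega>) \<partial>M) = (\<integral>\<omega>. X \<omega> \<partial>M) * (\<integral>w. \<psi> (Z t w) \<partial>N)"
proof -
  note I = increment_integral[OF assms(1,2) \<psi>(1)]
  note ind = increment(3,4)[OF assms(1,2) X(1) \<psi>(1)]
  have int: "integrable M (\<lambda>\<omega>. \<psi> (b s t \<omega>))" "integrable M (\<lambda>\<omega>. \<psi> (b' s t \<omega>))"
    using I \<psi>(2) by auto
  show "integrable M (\<lambda>\<omega>. X \<omega> * \<psi> (b s t \<omega>))" "integrable M (\<lambda>\<omega>. X \<omega> * \<psi> (b' s t \<omega>))"
    using M.indep_var_integrable[OF ind(1) X(2) int(1)] M.indep_var_integrable[OF ind(2) X(2) int(2)] .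
  show "(\<integral>\<omega>. X \<omega> * \<psi> (b s t \<omega>) \<partial>M) = (\<integral>\<omega>. X \<omega> \<partial>M) * (\<integral>w. \<psi> (Z t w) \<partial>N)"
    "(\<integral>\<omega>. X \<omega> * \<psi> (b' s t \<omega>) \<partial>M) = (\<integral>\<omega>. X \<omega> \<partial>M) * (\<integral>w. \<psi> (Z t w) \<partial>N)"
    using M.indep_var_lebesgue_integral[OF ind(1) X(2) int(1)] M.indep_var_lebesgue_integral[OF ind(2) X(2) int(2)] I
    by simp_all
qed

lemma increment_square_integrable:
  fixes \<psi> :: "heis \<Rightarrow> real"
  assumes "s \<ge> 0" "t \<ge> 0" and [measurable]: "\<psi> \<in> borel_measurable borel"
    and "square_integrable N (\<lambda>w. \<psi> (Z t w))"
  shows "square_integrable M (\<lambda>\<omega>. \<psi> (b s t \<omega>))" "square_integrable M (\<lambda>\<omega>. \<psi> (b' s t \<omega>))"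
  using increment_integral(3,4)[OF assms(1,2), of "\<lambda>p. (\<psi> p)\<^sup>2"] assms b_measurable[OF assms(1,2)]
  unfolding square_integrable_def by (auto intro: measurable_compose)

lemma borel_measurable_coordinates [measurable]:
  "(fst :: heis \<Rightarrow> real) \<in> borel_measurable borel"
  "(\<lambda>p::heis. fst (snd p)) \<in> borel_measurable borel" "(\<lambda>p::heis. snd (snd p)) \<in> borel_measurable borel"
  by measurable

text \<open>Left translation by \<open>p\<close> merely shifts the planar coordinates. The process
  \<open>C\<close> is generic in order to serve for both \<open>B\<close> and
  \<open>B'\<close>.\<close>

lemma start_moments:
  assumes "s > 0" "heis_bm N Z p M C" and [measurable]: "C s \<in> borel_measurable M"
  shows "square_integrable M (\<lambda>\<omega>. fst (C s \<omega>))" "square_integrable M (\<lambda>\<omega>. fst (snd (C s \<omega>)))"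
    "(\<integral>\<omega>. fst (C s \<omega>) \<partial>M) = fst p" "(\<integral>\<omega>. fst (snd (C s \<omega>)) \<partial>M) = fst (snd p)"
proof -
  note [measurable] = Z_measurable[OF less_imp_le[OF assms(1)]]
  have d: "distr M borel (C s) = distr N borel (\<lambda>w. heis_mult p (Z s w))"
    using heis_bm_distr[OF assms(2)] assms(1) Z_measurable by simp
  note Zm = Z_moments[OF assms(1)]
  have m: "(\<lambda>w. heis_mult p (Z s w)) \<in> borel_measurable N" by measurable
  have eq: "(\<integral>\<omega>. \<psi> (C s \<omega>) \<partial>M) = (\<integral>w. \<psi> (heis_mult p (Z s w)) \<partial>N)"
    "square_integrable M (\<lambda>\<omega>. \<psi> (C s \<omega>)) \<longleftrightarrow> square_integrable N (\<lambda>w. \<psi> (heis_mult p (Z s w)))"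
    if [measurable]: "\<psi> \<in> borel_measurable borel" for \<psi> :: "heis \<Rightarrow> real"
    using arg_cong[OF d, of "\<lambda>m. integral\<^sup>L m \<psi>"] arg_cong[OF d, of "\<lambda>m. square_integrable m \<psi>"] m
    by (simp_all add: integral_distr square_integrable_distr)
  show "square_integrable M (\<lambda>\<omega>. fst (C s \<omega>))" "square_integrable M (\<lambda>\<omega>. fst (snd (C s \<omega>)))"
    using eq(2)[of fst] eq(2)[of "\<lambda>p. fst (snd p)"] Zm
    by (simp_all add: heis_mult_eq square_integrable_add N.square_integrable_const)
  have "integrable N (\<lambda>w. fst (Z s w))" "integrable N (\<lambda>w. fst (snd (Z s w)))"
    using Zm N.square_integrable_imp_integrable by auto
  then show "(\<integral>\<omega>. fst (C s \<omega>) \<partial>M) = fst p" "(\<integral>\<omega>. fst (snd (C s \<omega>)) \<partial>M) = fst (snd p)"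
    using eq(1)[of fst] eq(1)[of "\<lambda>p. fst (snd p)"] Zm
    by (simp_all add: heis_mult_eq N.prob_space)
qed

text \<open>The mean planar difference keeps its initial value; it is what survives in the tested
  identity.\<close>

lemma R_moments:
  assumes "s > 0"
  shows "square_integrable M (R1 s)" "square_integrable M (R2 s)"
    "(\<integral>\<omega>. R1 s \<omega> \<partial>M) = fst a' - fst a" "(\<integral>\<omega>. R2 s \<omega> \<partial>M) = fst (snd a') - fst (snd a)"
proof -
  note m = start_moments[OF assms bm] start_moments[OF assms bm']
  note [measurable] = B_measurable[OF less_imp_le[OF assms]]
  show "square_integrable M (R1 s)" "square_integrable M (R2 s)"
    unfolding R1_def[abs_def] R2_def[abs_def] by (intro square_integrable_diff m; measurable)+
  show "(\<integral>\<omega>. R1 s \<omega> \<partial>M) = fst a' - fst a" "(\<integral>\<omega>. R2 s \<omega> \<partial>M) = fst (snd a') - fst (snd a)"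
    unfolding R1_def R2_def using m by (simp_all add: M.square_integrable_imp_integrable)
qed

section \<open>Second moments of the planar difference\<close>

definition "V s = (\<integral>\<omega>. (R1 s \<omega>)\<^sup>2 \<partial>M) + (\<integral>\<omega>. (R2 s \<omega>)\<^sup>2 \<partial>M)"

definition "\<rho>1 s t \<omega> = fst (b' s t \<omega>) - fst (b s t \<omega>)"
definition "\<rho>2 s t \<omega> = fst (snd (b' s t \<omega>)) - fst (snd (b s t \<omega>))"

lemma \<rho>_square_integrable:
  assumes "s > 0" "t > 0"
  shows "square_integrable M (\<rho>1 s t)" "square_integrable M (\<rho>2 s t)"
  unfolding \<rho>1_def[abs_def] \<rho>2_def[abs_def]
  using assms Z_moments[OF assms(2)]
  by (intro square_integrable_diff increment_square_integrable[where \<psi>=fst]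
      increment_square_integrable[where \<psi>="\<lambda>p. fst (snd p)"]; simp)+

text \<open>The planar difference is a martingale, so its increments are orthogonal to its past.\<close>

lemma V_increment:
  assumes "s > 0" "t > 0"
  shows "V (s + t) = V s + ((\<integral>\<omega>. (\<rho>1 s t \<omega>)\<^sup>2 \<partial>M) + (\<integral>\<omega>. (\<rho>2 s t \<omega>)\<^sup>2 \<partial>M))"
proof -
  have st: "s \<ge> 0" "t \<ge> 0" using assms by auto
  note Zm = Z_moments[OF assms(2)] and Rm = R_moments[OF assms(1)]
  note Zi = N.square_integrable_imp_integrable[OF Zm(1)] N.square_integrable_imp_integrable[OF Zm(2)]
  note Ri = M.square_integrable_imp_integrable[OF Rm(1)] M.square_integrable_imp_integrable[OF Rm(2)]
  note I1 = increment_indep_integral[OF st borel_measurable_coordinates(1) Zi(1) R_measurable(1)[OF st(1)] Ri(1)]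
  note I2 = increment_indep_integral[OF st borel_measurable_coordinates(2) Zi(2) R_measurable(2)[OF st(1)] Ri(2)]
  have orth: "(\<integral>\<omega>. R1 s \<omega> * \<rho>1 s t \<omega> \<partial>M) = 0" "(\<integral>\<omega>. R2 s \<omega> * \<rho>2 s t \<omega> \<partial>M) = 0"
    unfolding \<rho>1_def \<rho>2_def right_diff_distrib using I1 I2 Zm(4,5) by simp_all
  have sq: "(\<integral>\<omega>. (f \<omega> + g \<omega>)\<^sup>2 \<partial>M) = (\<integral>\<omega>. (f \<omega>)\<^sup>2 \<partial>M) + (\<integral>\<omega>. (g \<omega>)\<^sup>2 \<partial>M)"
    if "square_integrable M f" "square_integrable M g" "(\<integral>\<omega>. f \<omega> * g \<omega> \<partial>M) = 0" for f g
    using that square_integrable_mult[OF that(1,2)]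
    by (simp add: square_integrable_def power2_sum mult.assoc)
  have "R1 (s + t) \<omega> = R1 s \<omega> + \<rho>1 s t \<omega>" "R2 (s + t) \<omega> = R2 s \<omega> + \<rho>2 s t \<omega>" for \<omega>
    by (simp_all add: R1_def R2_def \<rho>1_def \<rho>2_def b_def b'_def heis_ldiff_sel)
  then show ?thesis
    unfolding V_def by (simp add: sq[OF Rm(1) \<rho>_square_integrable(1)[OF assms] orth(1)]
        sq[OF Rm(2) \<rho>_square_integrable(2)[OF assms] orth(2)])
qed

text \<open>Otherwise \<open>V\<close> would gain at least \<epsilon> over each of the windows of
  length \<open>t\<close> that start at \<open>T\<close>, \<open>T + t\<close>,
  \<open>T + 2 t\<close> and so on, and would exceed \<open>C\<close>.\<close>

lemma small_increment:
  assumes "T > 0" "t > 0" "\<epsilon> > 0" and V: "\<And>s. s \<ge> T \<Longrightarrow> V s \<le> C"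
  shows "\<exists>s\<ge>T. (\<integral>\<omega>. (\<rho>1 s t \<omega>)\<^sup>2 \<partial>M) + (\<integral>\<omega>. (\<rho>2 s t \<omega>)\<^sup>2 \<partial>M) \<le> \<epsilon>"
proof (rule ccontr)
  assume *: "\<not> ?thesis"
  have inc: "V (s + t) \<ge> V s + \<epsilon>" if "s \<ge> T" for s
  proof -
    from * that have "(\<integral>\<omega>. (\<rho>1 s t \<omega>)\<^sup>2 \<partial>M) + (\<integral>\<omega>. (\<rho>2 s t \<omega>)\<^sup>2 \<partial>M) > \<epsilon>"
      by (meson not_le)
    then show ?thesis using V_increment[of s t] that assms(1,2) by simp
  qed
  have "V (T + real n * t) \<ge> real n * \<epsilon>" for n
  proof (induction n)
    case 0 show ?case by (simp add: V_def)
  next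
    case (Suc n)
    have "V (T + real n * t + t) \<ge> V (T + real n * t) + \<epsilon>"
      using assms by (intro inc) simp
    then show ?case using Suc by (simp add: algebra_simps)
  qed
  moreover obtain n where "real n * \<epsilon> > C"
    using ex_less_of_nat_mult[OF \<open>\<epsilon> > 0\<close>] by blast
  ultimately show False
    using V[of "T + real n * t"] assms by (smt (verit) mult_nonneg_nonneg of_nat_0_le_iff)
qed

section \<open>Testing the area against a function of the increment\<close>

text \<open>Takes expectations in \<open>heis_area_increment_bound\<close> over a window with small
  \<rho>. In the bound, one \<open>C\<close> comes from the area at the end of the window, the other
  from the area at its start, and 1 from all errors together.\<close>

lemma tested_area_bound:
  fixes \<phi> :: "heis \<Rightarrow> real"
  assumes "T > 0" "t > 0"
    and A: "\<And>s. s \<ge> T \<Longrightarrow> integrable M (A s)" "\<And>s. s \<ge> T \<Longrightarrow> (\<integral>\<omega>. \<bar>A s \<omega>\<bar> \<partial>M) \<le> C"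
    and R: "\<And>s. s \<ge> T \<Longrightarrow> (\<integral>\<omega>. (R1 s \<omega>)\<^sup>2 \<partial>M) \<le> C" "\<And>s. s \<ge> T \<Longrightarrow> (\<integral>\<omega>. (R2 s \<omega>)\<^sup>2 \<partial>M) \<le> C"
    and \<phi>: "\<phi> \<in> borel_measurable borel" "\<And>p. \<bar>\<phi> p\<bar> \<le> 1"
      "\<And>p q. \<bar>\<phi> p - \<phi> q\<bar> \<le> \<bar>fst q - fst p\<bar> + \<bar>fst (snd q) - fst (snd p)\<bar>"
  shows "\<bar>(fst a' - fst a) * (\<integral>w. fst (snd (Z t w)) * \<phi> (Z t w) \<partial>N)
      - (fst (snd a') - fst (snd a)) * (\<integral>w. fst (Z t w) * \<phi> (Z t w) \<partial>N)\<bar> \<le> 2 * C + 1"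
proof -
  let ?m = "\<lambda>f. \<integral>w. f (Z t w) \<partial>N"
  note Zm = Z_moments[OF \<open>t > 0\<close>]
  note [measurable] = \<phi>(1) Z_measurable[OF less_imp_le[OF \<open>t > 0\<close>]]
  \<comment> \<open>\<open>K - 3\<close> bounds the mean of the factor next to \<epsilon>. With
    \<open>\<epsilon> = 1 / K\<close> and the mean square of \<rho> at most
    \<open>\<epsilon>\<^sup>2\<close>, the errors sum to at most
    \<open>\<epsilon> * (K - 3) + 3 * \<epsilon> = 1\<close>.\<close>
  define K where "K = 2 * ?m (\<lambda>p. (snd (snd p))\<^sup>2) + 2 * C + ?m (\<lambda>p. (fst p)\<^sup>2) + ?m (\<lambda>p. (fst (snd p))\<^sup>2) + 3"
  have "0 \<le> (\<integral>\<omega>. \<bar>A T \<omega>\<bar> \<partial>M)" by simp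
  then have "C \<ge> 0" using A(2)[OF order_refl] by (rule order_trans)
  then have "K > 0" unfolding K_def by (intro add_nonneg_pos add_nonneg_nonneg) auto
  define \<epsilon> where "\<epsilon> = 1 / K"
  have "\<epsilon> > 0" using \<open>K > 0\<close> by (simp add: \<epsilon>_def)
  have "V s \<le> 2 * C" if "s \<ge> T" for s using R[OF that] by (simp add: V_def)
  from small_increment[OF \<open>T > 0\<close> \<open>t > 0\<close> _ this, of "\<epsilon>\<^sup>2"] \<open>\<epsilon> > 0\<close>
  obtain s where "s \<ge> T" and \<rho>: "(\<integral>\<omega>. (\<rho>1 s t \<omega>)\<^sup>2 \<partial>M) + (\<integral>\<omega>. (\<rho>2 s t \<omega>)\<^sup>2 \<partial>M) \<le> \<epsilon>\<^sup>2"
    by auto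
  have s: "s > 0" "s \<ge> 0" "t \<ge> 0" "s + t \<ge> T" using \<open>s \<ge> T\<close> \<open>T > 0\<close> \<open>t > 0\<close> by auto
  note Rm = R_moments[OF s(1)] and \<rho>m = \<rho>_square_integrable[OF s(1) \<open>t > 0\<close>]
  note Ri = M.square_integrable_imp_integrable[OF Rm(1)] M.square_integrable_imp_integrable[OF Rm(2)]
  have Z\<phi>: "integrable N (\<lambda>w. f (Z t w) * \<phi> (Z t w))"
    if "square_integrable N (\<lambda>w. f (Z t w))" for f :: "heis \<Rightarrow> real"
  proof -
    have "square_integrable N (\<lambda>w. \<phi> (Z t w) * f (Z t w))"
      using \<phi>(2) by (intro square_integrable_bounded_mult[OF _ _ that, of _ 1]) auto
    then show ?thesis by (simp add: N.square_integrable_imp_integrable mult.commute)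
  qed
  have \<phi>i: "integrable N (\<lambda>w. \<phi> (Z t w))"
    using \<phi>(2) by (intro N.integrable_const_bound[where B=1]) auto
  note IA = increment_indep_integral(1,3)[OF s(2,3) \<phi>(1) \<phi>i R_measurable(3)[OF s(2)] A(1)[OF \<open>s \<ge> T\<close>]]
  note I1 = increment_indep_integral(1,3)[OF s(2,3) _ Z\<phi>[OF Zm(2)] R_measurable(1)[OF s(2)] Ri(1), simplified]
  note I2 = increment_indep_integral(1,3)[OF s(2,3) _ Z\<phi>[OF Zm(1)] R_measurable(2)[OF s(2)] Ri(2), simplified]
  have \<zeta>\<phi>: "(\<lambda>p::heis. snd (snd p) * \<phi> p) \<in> borel_measurable borel" by measurable
  note I3 = increment_integral[OF s(2,3) \<zeta>\<phi>]
  \<comment> \<open>\<open>Y\<close> and \<open>U\<close> are the two sides of the pointwise bound,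
    with \<open>f\<close> and \<open>f'\<close> the values of \<phi> at the two increments.\<close>
  define Y where "Y \<omega> = A s \<omega> * \<phi> (b s t \<omega>) + R1 s \<omega> * (fst (snd (b s t \<omega>)) * \<phi> (b s t \<omega>))
    - R2 s \<omega> * (fst (b s t \<omega>) * \<phi> (b s t \<omega>))
    + (snd (snd (b' s t \<omega>)) * \<phi> (b' s t \<omega>) - snd (snd (b s t \<omega>)) * \<phi> (b s t \<omega>))" for \<omega>
  define U where "U \<omega> = \<bar>A (s + t) \<omega>\<bar> + \<epsilon> * (2 * (snd (snd (b' s t \<omega>)))\<^sup>2 + (R1 s \<omega>)\<^sup>2 + (R2 s \<omega>)\<^sup>2
      + (fst (b s t \<omega>))\<^sup>2 + (fst (snd (b s t \<omega>)))\<^sup>2) + 3 / \<epsilon> * ((\<rho>1 s t \<omega>)\<^sup>2 + (\<rho>2 s t \<omega>)\<^sup>2)" for \<omega>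
  have YU: "\<bar>Y \<omega>\<bar> \<le> U \<omega>" for \<omega>
    using heis_area_increment_bound[OF \<open>\<epsilon> > 0\<close> \<phi>(2)[of "b s t \<omega>"], of "\<phi> (b' s t \<omega>)" "B' s \<omega>" "B' (s + t) \<omega>"
        "B s \<omega>" "B (s + t) \<omega>"] \<phi>(3)[of "b s t \<omega>" "b' s t \<omega>"]
    unfolding Y_def U_def A_def R1_def R2_def \<rho>1_def \<rho>2_def b_def b'_def by simp
  have \<zeta>i: "integrable M (\<lambda>\<omega>. snd (snd (b s t \<omega>)) * \<phi> (b s t \<omega>))"
    "integrable M (\<lambda>\<omega>. snd (snd (b' s t \<omega>)) * \<phi> (b' s t \<omega>))"
    using I3(3,4) Z\<phi>[OF Zm(3)] by simp_all
  have Yint: "integrable M Y"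
    unfolding Y_def using IA(1) I1(1) I2(1) \<zeta>i by (intro Bochner_Integration.integrable_add Bochner_Integration.integrable_diff)
  \<comment> \<open>The products factor by independence of \<open>F s\<close>. The two area terms
    cancel because each involves only one increment and both increments have the law of
    \<open>Z t\<close>.\<close>
  have Yeq: "(\<integral>\<omega>. Y \<omega> \<partial>M) = (\<integral>\<omega>. A s \<omega> \<partial>M) * ?m \<phi>
      + ((fst a' - fst a) * ?m (\<lambda>p. fst (snd p) * \<phi> p) - (fst (snd a') - fst (snd a)) * ?m (\<lambda>p. fst p * \<phi> p))"
    unfolding Y_def using IA I1 I2 \<zeta>i I3(1,2) Rm(3,4) by simp
  have sq: "integrable M (\<lambda>\<omega>. (f (b s t \<omega>))\<^sup>2)" "integrable M (\<lambda>\<omega>. (f (b' s t \<omega>))\<^sup>2)"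
    "(\<integral>\<omega>. (f (b s t \<omega>))\<^sup>2 \<partial>M) = ?m (\<lambda>p. (f p)\<^sup>2)" "(\<integral>\<omega>. (f (b' s t \<omega>))\<^sup>2 \<partial>M) = ?m (\<lambda>p. (f p)\<^sup>2)"
    if "f \<in> borel_measurable borel" "square_integrable N (\<lambda>w. f (Z t w))" for f :: "heis \<Rightarrow> real"
    using increment_integral[OF s(2,3), of "\<lambda>p. (f p)\<^sup>2"] that by (simp_all add: square_integrable_def)
  note sqs = sq[OF borel_measurable_coordinates(1) Zm(1)] sq[OF borel_measurable_coordinates(2) Zm(2)]
    sq[OF borel_measurable_coordinates(3) Zm(3)]
  note ints = sqs(1,2,5,6,9,10) A(1)[OF s(4)] Rm(1,2)[unfolded square_integrable_def, THEN conjunct2]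
    \<rho>m[unfolded square_integrable_def, THEN conjunct2]
  have Uint: "integrable M U" unfolding U_def using ints by simp
  have "(\<integral>\<omega>. U \<omega> \<partial>M) = (\<integral>\<omega>. \<bar>A (s + t) \<omega>\<bar> \<partial>M)
      + \<epsilon> * (2 * ?m (\<lambda>p. (snd (snd p))\<^sup>2) + (\<integral>\<omega>. (R1 s \<omega>)\<^sup>2 \<partial>M) + (\<integral>\<omega>. (R2 s \<omega>)\<^sup>2 \<partial>M)
        + ?m (\<lambda>p. (fst p)\<^sup>2) + ?m (\<lambda>p. (fst (snd p))\<^sup>2))
      + 3 / \<epsilon> * ((\<integral>\<omega>. (\<rho>1 s t \<omega>)\<^sup>2 \<partial>M) + (\<integral>\<omega>. (\<rho>2 s t \<omega>)\<^sup>2 \<partial>M))"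
    unfolding U_def using ints sqs by simp
  also have "\<dots> \<le> C + \<epsilon> * (K - 3) + 3 / \<epsilon> * \<epsilon>\<^sup>2"
    using A(2)[OF s(4)] R[OF \<open>s \<ge> T\<close>] \<rho> \<open>\<epsilon> > 0\<close>
    by (intro add_mono mult_left_mono) (auto simp: K_def)
  also have "\<dots> = C + 1"
    using \<open>K > 0\<close> by (simp add: \<epsilon>_def field_simps power2_eq_square)
  finally have "(\<integral>\<omega>. U \<omega> \<partial>M) \<le> C + 1" .
  moreover have "\<bar>\<integral>\<omega>. Y \<omega> \<partial>M\<bar> \<le> (\<integral>\<omega>. U \<omega> \<partial>M)"
    using YU by (intro order_trans[OF integral_abs_bound] integral_mono integrable_abs Yint Uint)
  ultimately have Y: "\<bar>\<integral>\<omega>. Y \<omega> \<partial>M\<bar> \<le> C + 1" by linarith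
  have "\<bar>\<integral>\<omega>. A s \<omega> \<partial>M\<bar> \<le> C"
    using A(2)[OF \<open>s \<ge> T\<close>] integral_abs_bound[of M "A s"] by linarith
  moreover have "\<bar>?m \<phi>\<bar> \<le> 1"
  proof -
    have "\<bar>?m \<phi>\<bar> \<le> (\<integral>w. \<bar>\<phi> (Z t w)\<bar> \<partial>N)" by (rule integral_abs_bound)
    also have "\<dots> \<le> (\<integral>w. 1 \<partial>N)" using \<phi>(2) \<phi>i by (intro integral_mono) auto
    finally show ?thesis by (simp add: N.prob_space)
  qed
  ultimately have "\<bar>(\<integral>\<omega>. A s \<omega> \<partial>M) * ?m \<phi>\<bar> \<le> C * 1"
    unfolding abs_mult by (intro mult_mono) auto
  with Y show ?thesis unfolding Yeq by linarith
qed

section \<open>Truncated coordinates as test functions\<close>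

definition clip :: "real \<Rightarrow> real" where "clip u = max (-1) (min 1 u)"

text \<open>The first three properties are what \<open>tested_area_bound\<close> asks of \<phi>; the
  last one passes the growth of the absolute moment on to the tested moment.\<close>

lemma clip: "clip \<in> borel_measurable borel" "\<bar>clip u\<bar> \<le> 1" "\<bar>clip u - clip v\<bar> \<le> \<bar>v - u\<bar>" "u * clip u \<ge> \<bar>u\<bar> - 1"
proof -
  show "clip \<in> borel_measurable borel" unfolding clip_def[abs_def] by measurable
  show "\<bar>clip u\<bar> \<le> 1" "\<bar>clip u - clip v\<bar> \<le> \<bar>v - u\<bar>" unfolding clip_def by linarith+
  show "u * clip u \<ge> \<bar>u\<bar> - 1"
  proof (cases "\<bar>u\<bar> \<le> 1")
    case True
    then have "u * clip u \<ge> 0" by (auto simp: clip_def zero_le_mult_iff)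
    with True show ?thesis by linarith
  next
    case False
    then show ?thesis by (auto simp: clip_def abs_if max_def min_def)
  qed
qed

text \<open>Mixed moments vanish since the planar coordinates are independent and centred, so each
  test function isolates one component of the initial difference.\<close>

lemma clip_moments:
  assumes "t > 0"
  shows "(\<integral>w. fst (Z t w) * clip (fst (snd (Z t w))) \<partial>N) = 0"
    "(\<integral>w. fst (snd (Z t w)) * clip (fst (Z t w)) \<partial>N) = 0"
    "(\<integral>w. fst (Z t w) * clip (fst (Z t w)) \<partial>N) \<ge> sqrt t * sqrt (2 / pi) - 1"
    "(\<integral>w. fst (snd (Z t w)) * clip (fst (snd (Z t w))) \<partial>N) \<ge> sqrt t * sqrt (2 / pi) - 1"
proof -
  note Zm = Z_moments[OF assms]
  note [measurable] = Z_measurable[OF less_imp_le[OF assms]] clip(1)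
  note Zi = N.square_integrable_imp_integrable[OF Zm(1)] N.square_integrable_imp_integrable[OF Zm(2)]
  have ci: "integrable N (\<lambda>w. clip (fst (Z t w)))" "integrable N (\<lambda>w. clip (fst (snd (Z t w))))"
    using clip(2) by (auto intro!: N.integrable_const_bound[where B=1])
  have ind: "N.indep_var borel (\<lambda>w. fst (Z t w)) borel (\<lambda>w. fst (snd (Z t w)))"
    using heis_bm_model_facts(5)[OF model] assms by simp
  have id: "(\<lambda>u::real. u) \<in> borel_measurable borel" by simp
  from N.indep_var_lebesgue_integral[OF N.indep_var_compose[OF ind id clip(1), unfolded comp_def] Zi(1) ci(2)] Zm(4)
  show "(\<integral>w. fst (Z t w) * clip (fst (snd (Z t w))) \<partial>N) = 0" by simp
  from N.indep_var_lebesgue_integral[OF N.indep_var_compose[OF ind clip(1) id, unfolded comp_def] ci(1) Zi(2)] Zm(5)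
  show "(\<integral>w. fst (snd (Z t w)) * clip (fst (Z t w)) \<partial>N) = 0" by (simp add: mult.commute)
  have ge: "(\<integral>w. f w * clip (f w) \<partial>N) \<ge> (\<integral>w. \<bar>f w\<bar> \<partial>N) - 1"
    if "square_integrable N f" for f
  proof -
    note [measurable] = square_integrable_measurable[OF that]
    have f: "integrable N f" by (rule N.square_integrable_imp_integrable[OF that])
    have "square_integrable N (\<lambda>w. clip (f w) * f w)"
      using clip(2) by (intro square_integrable_bounded_mult[OF _ _ that, of _ 1]) auto
    then have fc: "integrable N (\<lambda>w. f w * clip (f w))"
      by (simp add: N.square_integrable_imp_integrable mult.commute)
    have "(\<integral>w. \<bar>f w\<bar> - 1 \<partial>N) \<le> (\<integral>w. f w * clip (f w) \<partial>N)"
      using f fc clip(4) by (intro integral_mono) auto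
    then show ?thesis using f by (simp add: N.prob_space)
  qed
  show "(\<integral>w. fst (Z t w) * clip (fst (Z t w)) \<partial>N) \<ge> sqrt t * sqrt (2 / pi) - 1"
    "(\<integral>w. fst (snd (Z t w)) * clip (fst (snd (Z t w))) \<partial>N) \<ge> sqrt t * sqrt (2 / pi) - 1"
    using ge[OF Zm(1)] ge[OF Zm(2)] Zm(6,7) by simp_all
qed

text \<open>Clipping the second coordinate leaves the first component of the initial difference
  times a moment that is unbounded in \<open>t\<close>, and conversely. As the product stays
  bounded, the component is 0.\<close>

lemma moments_bounded_imp_same_plane_point:
  assumes "T > 0"
    and A: "\<And>s. s \<ge> T \<Longrightarrow> integrable M (A s)" "\<And>s. s \<ge> T \<Longrightarrow> (\<integral>\<omega>. \<bar>A s \<omega>\<bar> \<partial>M) \<le> C"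
    and R: "\<And>s. s \<ge> T \<Longrightarrow> (\<integral>\<omega>. (R1 s \<omega>)\<^sup>2 \<partial>M) \<le> C" "\<And>s. s \<ge> T \<Longrightarrow> (\<integral>\<omega>. (R2 s \<omega>)\<^sup>2 \<partial>M) \<le> C"
  shows "fst a' = fst a" "fst (snd a') = fst (snd a)"
proof -
  note [measurable] = clip(1)
  have zero: "d = 0" if le: "\<And>t. t > 0 \<Longrightarrow> \<bar>d * g t\<bar> \<le> 2 * C + 1"
    and g: "\<And>t. t > 0 \<Longrightarrow> g t \<ge> sqrt t * sqrt (2 / pi) - 1" for d :: real and g
  proof (rule ccontr)
    assume "d \<noteq> 0"
    \<comment> \<open>Chosen so that \<open>\<bar>d\<bar> * m\<close> exceeds
      \<open>2 * C + 1\<close>; \<open>t\<close> is then the time at which the lower bound for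
      \<open>g t\<close> equals \<open>m\<close>.\<close>
    define m where "m = (\<bar>2 * C + 1\<bar> + 1) / \<bar>d\<bar>"
    define t where "t = ((m + 1) / sqrt (2 / pi))\<^sup>2"
    have "m > 0" using \<open>d \<noteq> 0\<close> by (simp add: m_def)
    then have "t > 0" by (simp add: t_def)
    have "sqrt t * sqrt (2 / pi) = m + 1"
      using \<open>m > 0\<close> by (simp add: t_def)
    then have "g t \<ge> m" using g[OF \<open>t > 0\<close>] by simp
    then have "\<bar>d * g t\<bar> \<ge> \<bar>d\<bar> * m"
      unfolding abs_mult by (intro mult_left_mono) auto
    moreover have "\<bar>d\<bar> * m = \<bar>2 * C + 1\<bar> + 1" using \<open>d \<noteq> 0\<close> by (simp add: m_def)
    ultimately show False using le[OF \<open>t > 0\<close>] by linarith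
  qed
  note bound = tested_area_bound[OF \<open>T > 0\<close> _ A R]
  have m: "(\<lambda>p::heis. clip (fst (snd p))) \<in> borel_measurable borel" "(\<lambda>p::heis. clip (fst p)) \<in> borel_measurable borel"
    by measurable
  have c: "\<bar>clip (fst (snd p)) - clip (fst (snd q))\<bar> \<le> \<bar>fst q - fst p\<bar> + \<bar>fst (snd q) - fst (snd p)\<bar>"
    "\<bar>clip (fst p) - clip (fst q)\<bar> \<le> \<bar>fst q - fst p\<bar> + \<bar>fst (snd q) - fst (snd p)\<bar>" for p q :: heis
    using clip(3)[of "fst (snd p)" "fst (snd q)"] clip(3)[of "fst p" "fst q"] by linarith+
  have "fst a' - fst a = 0"
    by (rule zero[of _ "\<lambda>t. \<integral>w. fst (snd (Z t w)) * clip (fst (snd (Z t w))) \<partial>N"])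
      (use bound[OF _ _ _ _ _ m(1) clip(2) c(1)] clip_moments in simp_all)
  moreover have "fst (snd a') - fst (snd a) = 0"
    by (rule zero[of _ "\<lambda>t. \<integral>w. fst (Z t w) * clip (fst (Z t w)) \<partial>N"])
      (use bound[OF _ _ _ _ _ m(2) clip(2) c(2)] clip_moments in simp_all)
  ultimately show "fst a' = fst a" "fst (snd a') = fst (snd a)" by simp_all
qed

end

section \<open>Unboundedness of the mean square distance\<close>

theorem theorem1p7:
  fixes N :: "'w measure" and Z :: "real \<Rightarrow> 'w \<Rightarrow> heis"
    and M :: "'a measure" and F :: "real \<Rightarrow> 'a measure"
    and B B' :: "real \<Rightarrow> 'a \<Rightarrow> heis"
    and x y z x' y' z' :: real
  assumes "heis_bm_model N Z"
    and "heis_bm N Z (x, y, z) M B"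
    and "heis_bm N Z (x', y', z') M B'"
    and "co_adapted N Z M F B B'"
    and "(x' - x)\<^sup>2 + (y' - y)\<^sup>2 > 0"
  shows "Limsup at_top (\<lambda>t. \<integral>\<^sup>+ \<omega>. (heis_dist (B t \<omega>) (B' t \<omega>))\<^sup>2 \<partial>M) = \<infinity>"
proof (rule ccontr)
  let ?D = "\<lambda>t. \<integral>\<^sup>+ \<omega>. (heis_dist (B t \<omega>) (B' t \<omega>))\<^sup>2 \<partial>M"
  interpret heis_coupling M N Z F B B' "(x, y, z)" "(x', y', z')"
    using assms heis_bm_model_facts(1)[OF assms(1)]
    by (auto simp: heis_coupling_def heis_coupling_axioms_def heis_bm_def)
  assume "Limsup at_top ?D \<noteq> \<infinity>"
  then obtain n :: nat where "Limsup at_top ?D < of_nat n"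
    using ennreal_Ex_less_of_nat by (auto simp: less_top)
  then have "\<forall>\<^sub>F t in at_top. ?D t < of_nat n" by (rule Limsup_lessD)
  then obtain T0 where T0: "\<And>t. t \<ge> T0 \<Longrightarrow> ?D t < of_nat n"
    unfolding eventually_at_top_linorder by blast
  \<comment> \<open>The maximum with 1 makes \<open>T\<close> positive, as the moment lemmas
    require.\<close>
  define T where "T = max T0 1"
  define C where "C = real n"
  have D: "?D s \<le> ennreal C" if "s \<ge> T" for s
    using T0[of s] that by (simp add: T_def C_def ennreal_of_nat_eq_real_of_nat less_imp_le)
  \<comment> \<open>Measurability is asked of \<open>g\<close> alone: \<open>nn_integral\<close> is
    monotone for arbitrary integrands, so the squared distance can serve as an upper bound as it
    stands.\<close>
  have dom: "integrable M g" "(\<integral>\<omega>. g \<omega> \<partial>M) \<le> C"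
    if "s \<ge> T" and g: "g \<in> borel_measurable M" "\<And>\<omega>. g \<omega> \<ge> 0"
      and le: "\<And>\<omega>. ennreal (g \<omega>) \<le> (heis_dist (B s \<omega>) (B' s \<omega>))\<^sup>2" for g s
  proof -
    have "(\<integral>\<^sup>+ \<omega>. ennreal (g \<omega>) \<partial>M) \<le> ?D s" by (intro nn_integral_mono le)
    with D[OF \<open>s \<ge> T\<close>] have nn: "(\<integral>\<^sup>+ \<omega>. ennreal (g \<omega>) \<partial>M) \<le> ennreal C" by order
    then show "integrable M g"
      using g by (intro integrableI_bounded) (auto simp: order_le_less_trans)
    with nn g show "(\<integral>\<omega>. g \<omega> \<partial>M) \<le> C"
      by (simp add: nn_integral_eq_integral C_def)
  qed
  have meas: "R1 s \<in> borel_measurable M" "R2 s \<in> borel_measurable M" "A s \<in> borel_measurable M"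
    if "s \<ge> T" for s
    using R_measurable_M[of s] that by (simp_all add: T_def)
  have sq: "ennreal (r\<^sup>2) \<le> d\<^sup>2" if "ennreal \<bar>r\<bar> \<le> d" for r :: real and d
    using power_mono[OF that, of 2] by (simp add: ennreal_power)
  have A: "integrable M (A s)" "(\<integral>\<omega>. \<bar>A s \<omega>\<bar> \<partial>M) \<le> C" if "s \<ge> T" for s
  proof -
    have m: "(\<lambda>\<omega>. \<bar>A s \<omega>\<bar>) \<in> borel_measurable M"
      using meas(3)[OF that] by (rule borel_measurable_abs)
    have le: "ennreal \<bar>A s \<omega>\<bar> \<le> (heis_dist (B s \<omega>) (B' s \<omega>))\<^sup>2" for \<omega>
      unfolding A_def by (rule heis_dist_bounds)
    have "integrable M (\<lambda>\<omega>. \<bar>A s \<omega>\<bar>)" by (rule dom(1)[OF that m _ le]) simp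
    then show "integrable M (A s)" using meas(3)[OF that] by (rule integrable_abs_cancel)
    show "(\<integral>\<omega>. \<bar>A s \<omega>\<bar> \<partial>M) \<le> C"
      by (rule dom(2)[OF that m _ le]) simp
  qed
  have R: "(\<integral>\<omega>. (R1 s \<omega>)\<^sup>2 \<partial>M) \<le> C" "(\<integral>\<omega>. (R2 s \<omega>)\<^sup>2 \<partial>M) \<le> C" if "s \<ge> T" for s
  proof -
    have m: "(\<lambda>\<omega>. (R1 s \<omega>)\<^sup>2) \<in> borel_measurable M" "(\<lambda>\<omega>. (R2 s \<omega>)\<^sup>2) \<in> borel_measurable M"
      using meas(1,2)[OF that] by (simp_all add: borel_measurable_power)
    have le: "ennreal ((R1 s \<omega>)\<^sup>2) \<le> (heis_dist (B s \<omega>) (B' s \<omega>))\<^sup>2"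
      "ennreal ((R2 s \<omega>)\<^sup>2) \<le> (heis_dist (B s \<omega>) (B' s \<omega>))\<^sup>2" for \<omega>
      unfolding R1_def R2_def by (intro sq heis_dist_bounds)+
    show "(\<integral>\<omega>. (R1 s \<omega>)\<^sup>2 \<partial>M) \<le> C" "(\<integral>\<omega>. (R2 s \<omega>)\<^sup>2 \<partial>M) \<le> C"
      using dom(2)[OF that m(1) _ le(1)] dom(2)[OF that m(2) _ le(2)] by simp_all
  qed
  have "T > 0" by (simp add: T_def)
  from moments_bounded_imp_same_plane_point[OF this A R] assms(5) show False by simp
qed

end
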